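(* Let $X,Z,U,Y$ be Hilbert spaces, $E\in L(X,Z)$, $B\in L(U,Z)$, $C\in L(X,Y)$, let $A:X\supseteq D(A)\to Z$ be closed and densely defined, and let $t_f>0$. Assume that there are $M>0$ and $\omega<0$ such that $\{\lambda\in\mathbb{C}:\operatorname{Re}\lambda>\omega\}\subseteq\rho(E,A)$ and $$\|(A-\lambda E)^{-1}E\|\le\frac{M}{\lambda-\omega}\quad\text{for all real }\lambda>\omega,$$ that the associated degenerate semigroup $T$ is exponentially stable, and that the transfer function $s\mapsto C(sE-A)^{-1}B$ is bounded on the open right half-plane. Let $\mathcal{Q}\in L^\infty([0,t_f],L(Y))$, $\mathcal{R}\in L^\infty([0,t_f],L(U))$ be pointwise (a.e.) self-adjoint, let $\Psi$ be the output map and $\mathbb{F}$ the input-output operator of the system, and consider the cost (with cross term $\mathcal{N}=0$) $$J(u,x_0)=\int_0^{t_f}\bigl(\langle y(t),\mathcal{Q}(t)y(t)\rangle_Y+\langle u(t),\mathcal{R}(t)u(t)\rangle_U\bigr)\,\mathrm{d}t,\qquad y=\Psi x_0+\mathbb{F}u.$$ Assume that the Popov operator $\mathfrak{R}:=\mathcal{R}+\mathbb{F}^*\mathcal{Q}\mathbb{F}\in L(L^2([0,t_f],U))$ is coercive, i.e. there is $\varepsilon_0>0$ with $\langle u,\mathfrak{R}u\rangle\ge\varepsilon_0\|u\|^2$ for all $u\in L^2([0,t_f],U)$, and that there exists $\varepsilon>0$ such that $\langle\mathcal{R}u,u\rangle\ge\varepsilon\|u\|^2$ for all $u\in L^2([0,t_f],U)$.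 Let $x_0\in X$, let $u^{\rm opt}$ be the unique minimizer of $J(\cdot,x_0)$ over $L^2([0,t_f],U)$, and let $y=\Psi x_0+\mathbb{F}u^{\rm opt}$ be the corresponding output. Then $I-\mathfrak{R}^{-1}\mathbb{F}^*\mathcal{Q}\mathbb{F}$ is boundedly invertible and $$u^{\rm opt}(t)=-\bigl((I-\mathfrak{R}^{-1}\mathbb{F}^*\mathcal{Q}\mathbb{F})^{-1}\mathfrak{R}^{-1}\mathbb{F}^*\mathcal{Q}\,y\bigr)(t)\quad\text{for a.e. }t\in[0,t_f].$$
   Context: The underlying system is $\frac{\mathrm d}{\mathrm dt}Ex(t)=Ax(t)+Bu(t)$, $Ex(0)=Ex_0$, $y(t)=Cx(t)$. The resolvent set of the pair is $\rho(E,A):=\{\lambda\in\mathbb{C}:\lambda E-A:D(A)\to Z\text{ is bijective}\}$; since $\omega<0$, $0\in\rho(E,A)$, so $A$ is boundedly invertible. Functions $\mathcal{Q},\mathcal{R}$ are identified with the corresponding multiplication operators on $L^2$. Under the coercivity of $\mathfrak{R}$ the functional $J(\cdot,x_0)$ has a unique minimizer for every $x_0\in X$. Degenerate semigroup. Put $R_r(\lambda):=(A-\lambda E)^{-1}E\in L(X)$. Under the growth bound, $X=X_K\dotplus X_R$ with closed subspaces $X_K=\ker R_r(\lambda)$, $X_R=\overline{\operatorname{ran}R_r(\lambda)}$ independent of $\lambda$. Let $P\in L(X)$ be the projection with $\operatorname{ran}P=X_R$, $\ker P=X_K$. The operator $A_R$ on $X_R$ is defined by $\operatorname{graph}A_R=\{(R_r(\lambda)x,x+\lambda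 R_r(\lambda)x):x\in X_R\}$ (independent of $\lambda$), so $A_R^{-1}=A^{-1}E|_{X_R}$. It is a standing assumption that $A_R$ generates a $C_0$-semigroup $(T_R(t))_{t\ge0}$ on $X_R$; the associated degenerate semigroup is $T(t):=T_R(t)P$, and it is exponentially stable if $\|T(t)\|\le M'e^{-\delta t}$ for all $t\ge0$ with some $M',\delta>0$. Extrapolation. $X_{R,-1}$ is the completion of $X_R$ with respect to $\|(\lambda I-A_R)^{-1}\cdot\|_{X_R}$ (any $\lambda$ in the resolvent set of $A_R$); $A_R$ extends to a bounded operator $X_R\to X_{R,-1}$, again denoted $A_R$ below, and $T_R$ extends to a $C_0$-semigroup $T_{R,-1}$ on $X_{R,-1}$. Output map and input-output operator. Put $\hat B_1:=PA^{-1}B\in L(U,X_R)$ and $\hat B_0:=(I-P)A^{-1}B\in L(U,X_K)$. Then $\Psi:X\to L^2([0,t_f],Y)$, $(\Psi x_0)(t):=CT(t)x_0$, and $\mathbb{F}:L^2([0,t_f],U)\to L^2([0,t_f],Y)$ is $$(\mathbb{F}u)(t):=C\int_0^tT_{R,-1}(t-s)A_R\hat B_1u(s)\,\mathrm{d}s-C\hat B_0u(t).$$ This formula is understood for smooth $u$ (e.g. $u\in H^1([0,t_f],U)$, for which the integral takes values in $X_R$), and $\mathbb{F}$ denotes its unique bounded extension to $L^2([0,t_f],U)$, which exists because the transfer function is bounded on the right half-plane. *)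

theory Defs
  imports "HOL-Analysis.Analysis"
begin

section \<open>Complex Banach and Hilbert spaces\<close>

class complex_vector = real_vector +
  fixes scaleC :: "complex \<Rightarrow> 'a \<Rightarrow> 'a"  (infixr "*\<^sub>C" 75)
  assumes scaleC_add_right: "c *\<^sub>C (x + y) = c *\<^sub>C x + c *\<^sub>C y"
    and scaleC_add_left: "(c + d) *\<^sub>C x = c *\<^sub>C x + d *\<^sub>C x"
    and scaleC_scaleC: "c *\<^sub>C (d *\<^sub>C x) = (c * d) *\<^sub>C x"
    and scaleC_one: "1 *\<^sub>C x = x"
    and scaleR_scaleC: "r *\<^sub>R x = complex_of_real r *\<^sub>C x"

class complex_normed_vector = complex_vector + real_normed_vector +
  assumes norm_scaleC: "norm (c *\<^sub>C x) = cmod c * norm x"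

class cbanach = complex_normed_vector + banach

text \<open>The inner product is conjugate-linear in its first argument. The last axiom says that
  it induces the norm; it also contains positive definiteness.\<close>

class chilbert_space = cbanach +
  fixes cinner :: "'a \<Rightarrow> 'a \<Rightarrow> complex"
  assumes cinner_commute: "cinner x y = cnj (cinner y x)"
    and cinner_add_right: "cinner x (y + z) = cinner x y + cinner x z"
    and cinner_scaleC_right: "cinner x (c *\<^sub>C y) = c * cinner x y"
    and cinner_self: "cinner x x = complex_of_real ((norm x)\<^sup>2)"

instantiation complex :: chilbert_space
begin

definition scaleC_complex :: "complex \<Rightarrow> complex \<Rightarrow> complex" where
  "scaleC_complex c x = c * x"

definition cinner_complex :: "complex \<Rightarrow> complex \<Rightarrow> complex" where
  "cinner_complex x y = cnj x * y"

instance
  by standard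
    (simp_all add: scaleC_complex_def cinner_complex_def algebra_simps norm_mult
      scaleR_conv_of_real complex_norm_square del: of_real_power)

end

definition csubspace :: "'a::complex_vector set \<Rightarrow> bool" where
  "csubspace V \<longleftrightarrow> 0 \<in> V \<and> (\<forall>x\<in>V. \<forall>y\<in>V. x + y \<in> V) \<and> (\<forall>c. \<forall>x\<in>V. c *\<^sub>C x \<in> V)"

definition clinear_on :: "'a::complex_vector set \<Rightarrow> ('a \<Rightarrow> 'b::complex_vector) \<Rightarrow> bool" where
  "clinear_on V f \<longleftrightarrow> (\<forall>x\<in>V. \<forall>y\<in>V. f (x + y) = f x + f y) \<and>
     (\<forall>c. \<forall>x\<in>V. f (c *\<^sub>C x) = c *\<^sub>C f x)"

definition bounded_clinear_on ::
  "'a::complex_normed_vector set \<Rightarrow> ('a \<Rightarrow> 'b::complex_normed_vector) \<Rightarrow> bool" where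
  "bounded_clinear_on V f \<longleftrightarrow> clinear_on V f \<and> (\<exists>K. \<forall>x\<in>V. norm (f x) \<le> K * norm x)"

abbreviation bounded_clinear ::
  "('a::complex_normed_vector \<Rightarrow> 'b::complex_normed_vector) \<Rightarrow> bool" where
  "bounded_clinear f \<equiv> bounded_clinear_on UNIV f"

text \<open>An unbounded operator with domain \<open>D\<close> is a pair of the set \<open>D\<close> and a function whose values
  outside \<open>D\<close> are irrelevant.\<close>

definition closed_densely_defined ::
  "'a::complex_normed_vector set \<Rightarrow> ('a \<Rightarrow> 'b::complex_normed_vector) \<Rightarrow> bool" where
  "closed_densely_defined D A \<longleftrightarrow> csubspace D \<and> clinear_on D A \<and>
     closed {(x, A x) | x. x \<in> D} \<and> closure D = UNIV"

section \<open>Strongly continuous semigroups on closed subspaces\<close>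

definition C0_semigroup_on ::
  "'a::complex_normed_vector set \<Rightarrow> (real \<Rightarrow> 'a \<Rightarrow> 'a) \<Rightarrow> bool" where
  "C0_semigroup_on V T \<longleftrightarrow> csubspace V \<and> closed V \<and>
     (\<forall>t\<ge>0. T t ` V \<subseteq> V \<and> bounded_clinear_on V (T t)) \<and>
     (\<forall>x\<in>V. T 0 x = x) \<and>
     (\<forall>s\<ge>0. \<forall>t\<ge>0. \<forall>x\<in>V. T (s + t) x = T s (T t x)) \<and>
     (\<forall>x\<in>V. ((\<lambda>t. T t x) \<longlongrightarrow> x) (at_right 0))"

definition generator_graph ::
  "'a::complex_normed_vector set \<Rightarrow> (real \<Rightarrow> 'a \<Rightarrow> 'a) \<Rightarrow> ('a \<times> 'a) set" where
  "generator_graph V T =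
     {(x, y). x \<in> V \<and> ((\<lambda>h. (T h x - x) /\<^sub>R h) \<longlongrightarrow> y) (at_right 0)}"

text \<open>Resolvent set and resolvent of an operator in the space \<open>V\<close> that is given by its graph \<open>G\<close>.\<close>

definition graph_resolvent_set :: "'a::complex_vector set \<Rightarrow> ('a \<times> 'a) set \<Rightarrow> complex set" where
  "graph_resolvent_set V G = {\<mu>. bij_betw (\<lambda>(v, w). \<mu> *\<^sub>C v - w) G V}"

definition graph_resolvent :: "('a::complex_vector \<times> 'a) set \<Rightarrow> complex \<Rightarrow> 'a \<Rightarrow> 'a" where
  "graph_resolvent G \<mu> x = fst (inv_into G (\<lambda>(v, w). \<mu> *\<^sub>C v - w) x)"

section \<open>The operator pencil and its degenerate semigroup\<close>

definition pencil_resolvent_set ::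
  "('x \<Rightarrow> 'z) \<Rightarrow> 'x set \<Rightarrow> ('x \<Rightarrow> 'z::complex_vector) \<Rightarrow> complex set" where
  "pencil_resolvent_set E D A = {\<mu>. bij_betw (\<lambda>x. \<mu> *\<^sub>C E x - A x) D UNIV}"

definition right_resolvent ::
  "('x \<Rightarrow> 'z) \<Rightarrow> 'x set \<Rightarrow> ('x \<Rightarrow> 'z::complex_vector) \<Rightarrow> complex \<Rightarrow> 'x \<Rightarrow> 'x" where
  "right_resolvent E D A \<mu> x = inv_into D (\<lambda>v. A v - \<mu> *\<^sub>C E v) (E x)"

definition transfer_function ::
  "('x \<Rightarrow> 'z) \<Rightarrow> 'x set \<Rightarrow> ('x \<Rightarrow> 'z::complex_vector) \<Rightarrow> ('u \<Rightarrow> 'z) \<Rightarrow> ('x \<Rightarrow> 'y)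
     \<Rightarrow> complex \<Rightarrow> 'u \<Rightarrow> 'y" where
  "transfer_function E D A B C s u = C (inv_into D (\<lambda>x. s *\<^sub>C E x - A x) (B u))"

text \<open>\<open>X\<^sub>K\<close>, \<open>X\<^sub>R\<close> and the graph of \<open>A\<^sub>R\<close>; none of them depends on the choice of \<open>\<mu>\<close> in the
  resolvent set of the pencil.\<close>

definition space_K ::
  "('x::zero \<Rightarrow> 'z) \<Rightarrow> 'x set \<Rightarrow> ('x \<Rightarrow> 'z::complex_vector) \<Rightarrow> complex \<Rightarrow> 'x set" where
  "space_K E D A \<mu> = {x. right_resolvent E D A \<mu> x = 0}"

definition space_R ::
  "('x::topological_space \<Rightarrow> 'z) \<Rightarrow> 'x set \<Rightarrow> ('x \<Rightarrow> 'z::complex_vector) \<Rightarrow> complex \<Rightarrow> 'x set" where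
  "space_R E D A \<mu> = closure (range (right_resolvent E D A \<mu>))"

definition A_R_graph ::
  "('x::complex_normed_vector \<Rightarrow> 'z) \<Rightarrow> 'x set \<Rightarrow> ('x \<Rightarrow> 'z::complex_vector) \<Rightarrow> complex
     \<Rightarrow> ('x \<times> 'x) set" where
  "A_R_graph E D A \<mu> =
     {(right_resolvent E D A \<mu> x, x + \<mu> *\<^sub>C right_resolvent E D A \<mu> x) | x. x \<in> space_R E D A \<mu>}"

definition is_projection ::
  "('a::complex_normed_vector \<Rightarrow> 'a) \<Rightarrow> 'a set \<Rightarrow> 'a set \<Rightarrow> bool" where
  "is_projection P V W \<longleftrightarrow> bounded_clinear P \<and> (\<forall>x. P (P x) = P x) \<and>
     range P = V \<and> {x. P x = 0} = W"

definition exponentially_stable ::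
  "(real \<Rightarrow> 'a::real_normed_vector \<Rightarrow> 'a) \<Rightarrow> bool" where
  "exponentially_stable T \<longleftrightarrow>
     (\<exists>M' \<delta>. M' > 0 \<and> \<delta> > 0 \<and> (\<forall>t\<ge>0. \<forall>x. norm (T t x) \<le> M' * exp (- \<delta> * t) * norm x))"

text \<open>The completion \<open>V\<^sub>-\<^sub>1\<close> of \<open>V\<close> for the norm \<open>\<parallel>(\<mu>I - A)\<^sup>-\<^sup>1 \<cdot>\<parallel>\<close>, where \<open>A\<close> has graph \<open>G\<close> and
  generates \<open>T\<close> on \<open>V\<close>, is the whole type \<open>'w\<close>, with embedding \<open>\<iota>\<close>. A completion is unique up to
  isometric isomorphism, so the choice of \<open>'w\<close> and \<open>\<iota>\<close> is immaterial. \<open>A1 : V \<rightarrow> V\<^sub>-\<^sub>1\<close> and \<open>T1\<close>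
  are the extensions of \<open>A\<close> and \<open>T\<close>.\<close>

definition is_extrapolation ::
  "'a::complex_normed_vector set \<Rightarrow> ('a \<times> 'a) set \<Rightarrow> (real \<Rightarrow> 'a \<Rightarrow> 'a) \<Rightarrow> complex \<Rightarrow>
     ('a \<Rightarrow> 'w::cbanach) \<Rightarrow> ('a \<Rightarrow> 'w) \<Rightarrow> (real \<Rightarrow> 'w \<Rightarrow> 'w) \<Rightarrow> bool" where
  "is_extrapolation V G T \<mu> \<iota> A1 T1 \<longleftrightarrow>
     \<mu> \<in> graph_resolvent_set V G \<and>
     clinear_on V \<iota> \<and> (\<forall>x\<in>V. norm (\<iota> x) = norm (graph_resolvent G \<mu> x)) \<and>
     closure (\<iota> ` V) = UNIV \<and>
     bounded_clinear_on V A1 \<and> (\<forall>(v, w)\<in>G. A1 v = \<iota> w) \<and>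
     C0_semigroup_on UNIV T1 \<and> (\<forall>t\<ge>0. \<forall>x\<in>V. T1 t (\<iota> x) = \<iota> (T t x))"

section \<open>Hilbert-space valued Lebesgue and Sobolev spaces on an interval\<close>

text \<open>The Hilbert spaces need not be separable, so \<open>borel_measurable\<close> is not appropriate here.
  Elements of \<open>L\<^sup>2([0,t\<^sub>f])\<close> are represented by functions on the reals whose values outside
  \<open>[0,t\<^sub>f]\<close> are irrelevant; equality of classes is equality almost everywhere on \<open>[0,t\<^sub>f]\<close>.\<close>

definition strongly_measurable :: "'s measure \<Rightarrow> ('s \<Rightarrow> 'a::topological_space) \<Rightarrow> bool" where
  "strongly_measurable M f \<longleftrightarrow>
     (\<exists>s. (\<forall>n::nat. simple_function M (s n)) \<and> (AE x in M. (\<lambda>n. s n x) \<longlonglongrightarrow> f x))"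

definition L2 :: "real \<Rightarrow> (real \<Rightarrow> 'a::chilbert_space) set" where
  "L2 tf = {f. strongly_measurable (lebesgue_on {0..tf}) f \<and>
     integrable (lebesgue_on {0..tf}) (\<lambda>t. (norm (f t))\<^sup>2)}"

definition L2_inner ::
  "real \<Rightarrow> (real \<Rightarrow> 'a::chilbert_space) \<Rightarrow> (real \<Rightarrow> 'a) \<Rightarrow> complex" where
  "L2_inner tf f g = integral\<^sup>L (lebesgue_on {0..tf}) (\<lambda>t. cinner (f t) (g t))"

definition L2_norm :: "real \<Rightarrow> (real \<Rightarrow> 'a::chilbert_space) \<Rightarrow> real" where
  "L2_norm tf f = sqrt (integral\<^sup>L (lebesgue_on {0..tf}) (\<lambda>t. (norm (f t))\<^sup>2))"

definition L2_eq :: "real \<Rightarrow> (real \<Rightarrow> 'a) \<Rightarrow> (real \<Rightarrow> 'a) \<Rightarrow> bool" where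
  "L2_eq tf f g \<longleftrightarrow> (AE t in lebesgue_on {0..tf}. f t = g t)"

text \<open>The continuous representatives of the elements of \<open>H\<^sup>1([0,t\<^sub>f])\<close>: the functions
  \<open>u(t) = u(0) + \<integral>\<^sub>0\<^sup>t v(s) ds\<close> with \<open>v \<in> L\<^sup>2\<close>.\<close>

definition H1 :: "real \<Rightarrow> (real \<Rightarrow> 'a::chilbert_space) set" where
  "H1 tf = {u. \<exists>v\<in>L2 tf. \<forall>t\<in>{0..tf}. (v has_integral (u t - u 0)) {0..t}}"

text \<open>Bounded linear operators between \<open>L\<^sup>2\<close> spaces, acting on representatives. Almost everywhere
  equal arguments have almost everywhere equal images, by linearity and boundedness.\<close>

definition L2_bounded_operator ::
  "real \<Rightarrow> ((real \<Rightarrow> 'a::chilbert_space) \<Rightarrow> (real \<Rightarrow> 'b::chilbert_space)) \<Rightarrow> bool" where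
  "L2_bounded_operator tf S \<longleftrightarrow>
     (\<forall>u\<in>L2 tf. S u \<in> L2 tf) \<and>
     (\<forall>u\<in>L2 tf. \<forall>v\<in>L2 tf. L2_eq tf (S (\<lambda>t. u t + v t)) (\<lambda>t. S u t + S v t)) \<and>
     (\<forall>c. \<forall>u\<in>L2 tf. L2_eq tf (S (\<lambda>t. c *\<^sub>C u t)) (\<lambda>t. c *\<^sub>C S u t)) \<and>
     (\<exists>K. \<forall>u\<in>L2 tf. L2_norm tf (S u) \<le> K * L2_norm tf u)"

definition L2_adjoint ::
  "real \<Rightarrow> ((real \<Rightarrow> 'a::chilbert_space) \<Rightarrow> (real \<Rightarrow> 'b::chilbert_space))
     \<Rightarrow> (real \<Rightarrow> 'b) \<Rightarrow> (real \<Rightarrow> 'a)" where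
  "L2_adjoint tf S = (SOME S'. L2_bounded_operator tf S' \<and>
     (\<forall>u\<in>L2 tf. \<forall>y\<in>L2 tf. L2_inner tf (S u) y = L2_inner tf u (S' y)))"

definition L2_is_inverse ::
  "real \<Rightarrow> ((real \<Rightarrow> 'a::chilbert_space) \<Rightarrow> (real \<Rightarrow> 'b::chilbert_space))
     \<Rightarrow> ((real \<Rightarrow> 'b) \<Rightarrow> (real \<Rightarrow> 'a)) \<Rightarrow> bool" where
  "L2_is_inverse tf S S' \<longleftrightarrow> L2_bounded_operator tf S' \<and>
     (\<forall>u\<in>L2 tf. L2_eq tf (S' (S u)) u) \<and> (\<forall>v\<in>L2 tf. L2_eq tf (S (S' v)) v)"

definition L2_boundedly_invertible ::
  "real \<Rightarrow> ((real \<Rightarrow> 'a::chilbert_space) \<Rightarrow> (real \<Rightarrow> 'b::chilbert_space)) \<Rightarrow> bool" where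
  "L2_boundedly_invertible tf S \<longleftrightarrow> L2_bounded_operator tf S \<and> (\<exists>S'. L2_is_inverse tf S S')"

definition L2_inverse ::
  "real \<Rightarrow> ((real \<Rightarrow> 'a::chilbert_space) \<Rightarrow> (real \<Rightarrow> 'b::chilbert_space))
     \<Rightarrow> (real \<Rightarrow> 'b) \<Rightarrow> (real \<Rightarrow> 'a)" where
  "L2_inverse tf S = (SOME S'. L2_is_inverse tf S S')"

text \<open>The Bochner space \<open>L\<^sup>\<infinity>([0,t\<^sub>f], L(H))\<close>. The type \<open>'a \<Rightarrow>\<^sub>L 'a\<close> consists of the real-linear
  bounded operators with the operator norm, hence the explicit complex linearity.\<close>

definition Linf_op :: "real \<Rightarrow> (real \<Rightarrow> 'a::chilbert_space \<Rightarrow>\<^sub>L 'a) set" where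
  "Linf_op tf = {Q. strongly_measurable (lebesgue_on {0..tf}) Q \<and>
     (AE t in lebesgue_on {0..tf}. bounded_clinear (blinfun_apply (Q t))) \<and>
     (\<exists>K. AE t in lebesgue_on {0..tf}. norm (Q t) \<le> K)}"

definition pointwise_selfadjoint :: "real \<Rightarrow> (real \<Rightarrow> 'a::chilbert_space \<Rightarrow>\<^sub>L 'a) \<Rightarrow> bool" where
  "pointwise_selfadjoint tf Q \<longleftrightarrow> (AE t in lebesgue_on {0..tf}.
     \<forall>x y. cinner (blinfun_apply (Q t) x) y = cinner x (blinfun_apply (Q t) y))"

definition mult_op ::
  "(real \<Rightarrow> 'a::chilbert_space \<Rightarrow>\<^sub>L 'a) \<Rightarrow> (real \<Rightarrow> 'a) \<Rightarrow> (real \<Rightarrow> 'a)" where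
  "mult_op Q u = (\<lambda>t. blinfun_apply (Q t) (u t))"

section \<open>Output map, input-output operator, cost and Popov operator\<close>

definition output_map ::
  "(real \<Rightarrow> 'x \<Rightarrow> 'x) \<Rightarrow> ('x \<Rightarrow> 'y) \<Rightarrow> 'x \<Rightarrow> real \<Rightarrow> 'y" where
  "output_map T C x0 = (\<lambda>t. C (T t x0))"

definition B_hat_1 ::
  "'x set \<Rightarrow> ('x \<Rightarrow> 'z) \<Rightarrow> ('x \<Rightarrow> 'x) \<Rightarrow> ('u \<Rightarrow> 'z) \<Rightarrow> 'u \<Rightarrow> 'x" where
  "B_hat_1 D A P B u = P (inv_into D A (B u))"

definition B_hat_0 ::
  "'x::minus set \<Rightarrow> ('x \<Rightarrow> 'z) \<Rightarrow> ('x \<Rightarrow> 'x) \<Rightarrow> ('u \<Rightarrow> 'z) \<Rightarrow> 'u \<Rightarrow> 'x" where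
  "B_hat_0 D A P B u = inv_into D A (B u) - P (inv_into D A (B u))"

text \<open>\<open>F\<close> is the bounded operator on \<open>L\<^sup>2\<close> that extends the formula for \<open>u \<in> H\<^sup>1\<close>. The integral is
  taken in the extrapolation space; since its value lies in \<open>\<iota> ` V\<close>, it is pulled back to \<open>V\<close>
  along the injective embedding \<open>\<iota>\<close> before \<open>C\<close> is applied.\<close>

definition is_input_output_operator ::
  "real \<Rightarrow> 'x::chilbert_space set \<Rightarrow> ('x \<Rightarrow> 'w::cbanach) \<Rightarrow> ('x \<Rightarrow> 'w) \<Rightarrow> (real \<Rightarrow> 'w \<Rightarrow> 'w) \<Rightarrow>
     ('u::chilbert_space \<Rightarrow> 'x) \<Rightarrow> ('u \<Rightarrow> 'x) \<Rightarrow> ('x \<Rightarrow> 'y::chilbert_space) \<Rightarrow>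
     ((real \<Rightarrow> 'u) \<Rightarrow> (real \<Rightarrow> 'y)) \<Rightarrow> bool" where
  "is_input_output_operator tf V \<iota> A1 T1 B1 B0 C F \<longleftrightarrow>
     L2_bounded_operator tf F \<and>
     (\<forall>u\<in>H1 tf. L2_eq tf (F u)
        (\<lambda>t. C (inv_into V \<iota> (integral {0..t} (\<lambda>s. T1 (t - s) (A1 (B1 (u s)))))) - C (B0 (u t))))"

text \<open>The integrand is real by self-adjointness of the weights, so taking real parts only adjusts
  the type.\<close>

definition cost ::
  "real \<Rightarrow> (real \<Rightarrow> 'y::chilbert_space \<Rightarrow>\<^sub>L 'y) \<Rightarrow> (real \<Rightarrow> 'u::chilbert_space \<Rightarrow>\<^sub>L 'u) \<Rightarrow>
     ('x \<Rightarrow> real \<Rightarrow> 'y) \<Rightarrow> ((real \<Rightarrow> 'u) \<Rightarrow> (real \<Rightarrow> 'y)) \<Rightarrow> (real \<Rightarrow> 'u) \<Rightarrow> 'x \<Rightarrow> real" where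
  "cost tf Q R \<Psi> F u x0 = integral\<^sup>L (lebesgue_on {0..tf})
     (\<lambda>t. Re (cinner (\<Psi> x0 t + F u t) (blinfun_apply (Q t) (\<Psi> x0 t + F u t))) +
          Re (cinner (u t) (blinfun_apply (R t) (u t))))"

definition popov ::
  "real \<Rightarrow> (real \<Rightarrow> 'y::chilbert_space \<Rightarrow>\<^sub>L 'y) \<Rightarrow> (real \<Rightarrow> 'u::chilbert_space \<Rightarrow>\<^sub>L 'u) \<Rightarrow>
     ((real \<Rightarrow> 'u) \<Rightarrow> (real \<Rightarrow> 'y)) \<Rightarrow> (real \<Rightarrow> 'u) \<Rightarrow> (real \<Rightarrow> 'u)" where
  "popov tf Q R F u = (\<lambda>t. mult_op R u t + L2_adjoint tf F (mult_op Q (F u)) t)"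

text \<open>Used for self-adjoint operators only, for which the quadratic form is real.\<close>

definition L2_coercive ::
  "real \<Rightarrow> ((real \<Rightarrow> 'a::chilbert_space) \<Rightarrow> (real \<Rightarrow> 'a)) \<Rightarrow> bool" where
  "L2_coercive tf S \<longleftrightarrow>
     (\<exists>\<epsilon>>0. \<forall>u\<in>L2 tf. Re (L2_inner tf u (S u)) \<ge> \<epsilon> * (L2_norm tf u)\<^sup>2)"

text \<open>The operator \<open>I - \<RR>\<^sup>-\<^sup>1 F\<^sup>* Q F\<close>, where \<open>\<RR>\<close> is the Popov operator.\<close>

definition feedback_op ::
  "real \<Rightarrow> (real \<Rightarrow> 'y::chilbert_space \<Rightarrow>\<^sub>L 'y) \<Rightarrow> (real \<Rightarrow> 'u::chilbert_space \<Rightarrow>\<^sub>L 'u) \<Rightarrow>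
     ((real \<Rightarrow> 'u) \<Rightarrow> (real \<Rightarrow> 'y)) \<Rightarrow> (real \<Rightarrow> 'u) \<Rightarrow> (real \<Rightarrow> 'u)" where
  "feedback_op tf Q R F u =
     (\<lambda>t. u t - L2_inverse tf (popov tf Q R F) (L2_adjoint tf F (mult_op Q (F u))) t)"

end

theory Submission
  imports Defs
begin

text \<open>Write \<open>\<RR> = R + F\<^sup>* Q F\<close>. The first variation of the cost at the minimizer is
  \<open>R u + F\<^sup>* Q y = 0\<close>, and \<open>I - \<RR>\<^sup>-\<^sup>1 F\<^sup>* Q F = \<RR>\<^sup>-\<^sup>1 R\<close> is invertible because \<open>R\<close> and
  \<open>\<RR>\<close> are coercive. Applying \<open>\<RR>\<^sup>-\<^sup>1\<close> to \<open>R u = - F\<^sup>* Q y\<close> gives the feedback law. The output \<open>y\<close> lies in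
  \<open>L\<^sup>2\<close> because the orbits of the semigroup are continuous and \<open>F\<close> is bounded.\<close>

section \<open>Strongly measurable functions\<close>

text \<open>The difficulty lies less in the algebra than in the carrier. Elements of L2 are
  representatives, operators on them are linear only up to null sets, and the Hilbert spaces may be
  non-separable. Passing between members of a class is therefore an explicit congruence step through
  \<open>L2_eq\<close>, and measurability means being an a.e. limit of simple functions. Moreover
  \<open>L2_adjoint\<close> and \<open>L2_inverse\<close> are choices that say nothing until an
  adjoint and an inverse are shown to exist. Both existence proofs rest on minimising a coercive
  quadratic functional, which needs completeness of L2 and hence closure of strong measurability
  under a.e. limits. The first variation takes no derivative. Along a line through the minimizer,
  the increase of the cost is a nonnegative real quadratic polynomial without constant term, so its
  linear coefficient vanishes. Coercivity of the Popov operator acts twice: it supplies the inverse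
  of \<open>\<RR>\<close>, and it makes the quadratic coefficient nonnegative.\<close>

lemma complete_measure_lebesgue_on:
  assumes "S \<in> sets lebesgue"
  shows "complete_measure (lebesgue_on S)"
proof
  fix A B assume "B \<subseteq> A" "A \<in> null_sets (lebesgue_on S)"
  then have "B \<in> null_sets (lebesgue_on S)"
    using assms by (auto simp: null_sets_restrict_space intro: completion.complete2)
  then show "B \<in> sets (lebesgue_on S)" by auto
qed

lemma (in complete_measure) measurable_cong_AE:
  assumes f: "f \<in> measurable M N" and ae: "AE x in M. f x = g x"
    and g: "g \<in> space M \<rightarrow> space N"
  shows "g \<in> measurable M N"
proof (rule measurableI)
  fix A assume A: "A \<in> sets N"
  show "g -` A \<inter> space M \<in> sets M"
  proof (rule in_sets_AE)
    show "AE x in M. x \<in> f -` A \<inter> space M \<longleftrightarrow> x \<in> g -` A \<inter> space M"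
      using ae by eventually_elim auto
  qed (use f A in \<open>auto intro: measurable_sets\<close>)
qed (use g in auto)

text \<open>The limit theorem for measurable functions needs convergence everywhere. Overwriting all
  functions by one constant on a null set \<open>N\<close> gives this, and completeness of the
  measure carries measurability from the modified limit \<open>h\<close> back to
  \<open>g\<close>.\<close>

lemma (in complete_measure) borel_measurable_LIMSEQ_AE:
  fixes f :: "nat \<Rightarrow> 'a \<Rightarrow> 'b::metric_space"
  assumes f: "\<And>n. f n \<in> borel_measurable M" and lim: "AE x in M. (\<lambda>n. f n x) \<longlonglongrightarrow> g x"
  shows "g \<in> borel_measurable M"
proof -
  obtain N where N: "{x \<in> space M. \<not> (\<lambda>n. f n x) \<longlonglongrightarrow> g x} \<subseteq> N" "N \<in> null_sets M"
    using lim unfolding eventually_ae_filter by auto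
  define h where "h x = (if x \<in> N then undefined else g x)" for x
  have [measurable]: "N \<in> sets M" using N(2) by auto
  have "h \<in> borel_measurable M"
  proof (rule borel_measurable_LIMSEQ_metric)
    show "(\<lambda>x. if x \<in> N then undefined else f n x) \<in> borel_measurable M" for n
      using f[of n] by measurable
    show "(\<lambda>n. if x \<in> N then undefined else f n x) \<longlonglongrightarrow> h x" if "x \<in> space M" for x
      using N(1) that by (auto simp: h_def)
  qed
  moreover have "AE x in M. h x = g x"
    using AE_not_in[OF N(2)] by eventually_elim (simp add: h_def)
  ultimately show ?thesis by (rule measurable_cong_AE) auto
qed

lemma strongly_measurableE:
  assumes "strongly_measurable M f"
  obtains s where "\<And>n::nat. simple_function M (s n)" "AE x in M. (\<lambda>n. s n x) \<longlonglongrightarrow> f x"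
  using assms unfolding strongly_measurable_def by auto

lemma strongly_measurable_const [intro]: "strongly_measurable M (\<lambda>x. c)"
  unfolding strongly_measurable_def by (rule exI[of _ "\<lambda>n x. c"]) auto

lemma strongly_measurable_cong_AE:
  assumes "strongly_measurable M f" "AE x in M. f x = g x"
  shows "strongly_measurable M g"
proof -
  obtain s where s: "\<And>n::nat. simple_function M (s n)" "AE x in M. (\<lambda>n. s n x) \<longlonglongrightarrow> f x"
    using strongly_measurableE[OF assms(1)] by metis
  have "AE x in M. (\<lambda>n. s n x) \<longlonglongrightarrow> g x"
    using s(2) assms(2) by eventually_elim simp
  then show ?thesis
    unfolding strongly_measurable_def using s(1) by auto
qed

text \<open>The hypothesis on \<open>h\<close> is joint sequential continuity, which for sums, inner
  products and operator application is the matching limit rule. Unary maps are covered by an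
  \<open>h\<close> that ignores one argument.\<close>

lemma strongly_measurable_compose2:
  assumes f: "strongly_measurable M f" and g: "strongly_measurable M g"
    and h: "\<And>X Y x y. X \<longlonglongrightarrow> x \<Longrightarrow> Y \<longlonglongrightarrow> y \<Longrightarrow> (\<lambda>n. h (X n) (Y n)) \<longlonglongrightarrow> h x y"
  shows "strongly_measurable M (\<lambda>x. h (f x) (g x))"
proof -
  obtain s where s: "\<And>n::nat. simple_function M (s n)" "AE x in M. (\<lambda>n. s n x) \<longlonglongrightarrow> f x"
    using strongly_measurableE[OF f] by metis
  obtain r where r: "\<And>n::nat. simple_function M (r n)" "AE x in M. (\<lambda>n. r n x) \<longlonglongrightarrow> g x"
    using strongly_measurableE[OF g] by metis
  have "AE x in M. (\<lambda>n. h (s n x) (r n x)) \<longlonglongrightarrow> h (f x) (g x)"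
    using s(2) r(2) by eventually_elim (rule h)
  moreover have "simple_function M (\<lambda>x. h (s n x) (r n x))" for n
    using s(1) r(1) by (rule simple_function_compose2)
  ultimately show ?thesis
    unfolding strongly_measurable_def by (intro exI[of _ "\<lambda>n x. h (s n x) (r n x)"]) simp
qed

text \<open>Pettis' theorem in metric form. Unlike the definition, the right-hand side is visibly
  stable under limits. Conversely, \<open>f x\<close> is approximated by a nearest point among the
  first \<open>n + 1\<close> members of an enumeration of \<open>D\<close>.\<close>

lemma (in complete_measure) strongly_measurable_iff_separable_range:
  fixes f :: "'a \<Rightarrow> 'b::metric_space"
  shows "strongly_measurable M f \<longleftrightarrow>
    f \<in> borel_measurable M \<and> (\<exists>D. countable D \<and> (AE x in M. f x \<in> closure D))"
proof safe
  assume "strongly_measurable M f"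
  then obtain s where s: "\<And>n::nat. simple_function M (s n)" and
    lim: "AE x in M. (\<lambda>n. s n x) \<longlonglongrightarrow> f x"
    using strongly_measurableE by metis
  show "f \<in> borel_measurable M"
    using borel_measurable_simple_function[OF s] lim by (rule borel_measurable_LIMSEQ_AE)
  let ?D = "\<Union>n. s n ` space M"
  have "countable (s n ` space M)" for n
    using s[of n] by (simp add: simple_function_def countable_finite)
  then have "countable ?D" by simp
  moreover have "AE x in M. f x \<in> closure ?D"
    using lim AE_space
  proof eventually_elim
    case (elim x)
    then show ?case unfolding closure_sequential by (intro exI[of _ "\<lambda>n. s n x"]) auto
  qed
  ultimately show "\<exists>D. countable D \<and> (AE x in M. f x \<in> closure D)" by blast
next
  fix D assume f: "f \<in> borel_measurable M" and D: "countable D" and ae: "AE x in M. f x \<in> closure D"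
  show "strongly_measurable M f"
  proof (cases "D = {}")
    case True
    \<comment> \<open>The closure of the empty set is empty, so here every property holds almost
      everywhere and any constant serves.\<close>
    have "AE x in M. undefined = f x" using ae by eventually_elim (simp add: True)
    then show ?thesis by (rule strongly_measurable_cong_AE[OF strongly_measurable_const])
  next
    case False
    define d where "d = from_nat_into D"
    have d: "range d = D" unfolding d_def using False D by simp
    define P where "P n x k \<longleftrightarrow> k \<le> n \<and> (\<forall>i\<in>{..n}. dist (f x) (d k) \<le> dist (f x) (d i))" for n x k
    \<comment> \<open>Ties between nearest points are broken by the least index; this makes
      \<open>K n\<close> measurable, and its values stay in \<open>{..n}\<close>.\<close>
    define K where "K n x = (LEAST k. P n x k)" for n x
    have P: "P n x (K n x)" for n x
    proof -
      obtain k where "k \<in> {..n}" "\<forall>i\<in>{..n}. dist (f x) (d k) \<le> dist (f x) (d i)"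
        using ex_min_if_finite[of "(\<lambda>i. dist (f x) (d i)) ` {..n}"]
        by (fastforce simp: not_less)
      then have "P n x k" by (auto simp: P_def)
      then show ?thesis unfolding K_def by (rule LeastI)
    qed
    have [measurable]: "(\<lambda>x. dist (f x) c) \<in> borel_measurable M" for c
      by (rule measurable_compose[OF f])
        (intro borel_measurable_continuous_onI continuous_intros)
    have [measurable]: "K n \<in> measurable M (count_space UNIV)" for n
      unfolding K_def P_def by measurable
    have "simple_function M (\<lambda>x. d (K n x))" for n
    proof (rule simple_function_compose1[where f = "K n" and g = d])
      show "simple_function M (K n)"
        unfolding simple_function_def
        using finite_subset[of "K n ` space M" "{..n}"] P by (auto simp: P_def)
    qed
    moreover have "AE x in M. (\<lambda>n. d (K n x)) \<longlonglongrightarrow> f x"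
      using ae
    proof eventually_elim
      case (elim x)
      show ?case
      proof (rule metric_LIMSEQ_I)
        fix e :: real assume "e > 0"
        with elim obtain y where "y \<in> D" "dist y (f x) < e"
          unfolding closure_approachable by blast
        \<comment> \<open>From index \<open>m\<close> on, \<open>d m\<close> competes in the
          minimum, so the selected point is at least as close.\<close>
        then obtain m where m: "dist (d m) (f x) < e" using d by auto
        have "dist (d (K n x)) (f x) < e" if "n \<ge> m" for n
        proof -
          have "dist (f x) (d (K n x)) \<le> dist (f x) (d m)"
            using P[of n x] that by (auto simp: P_def)
          then show ?thesis using m by (simp add: dist_commute)
        qed
        then show "\<exists>no. \<forall>n\<ge>no. dist (d (K n x)) (f x) < e" by blast
      qed
    qed
    ultimately show ?thesis
      unfolding strongly_measurable_def by (intro exI[of _ "\<lambda>n x. d (K n x)"]) simp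
  qed
qed

text \<open>The countable sets that approximate the ranges of the \<open>f n\<close> have a
  countable union, whose closure contains the limit values.\<close>

lemma (in complete_measure) strongly_measurable_LIMSEQ:
  fixes f :: "nat \<Rightarrow> 'a \<Rightarrow> 'b::metric_space"
  assumes f: "\<And>n. strongly_measurable M (f n)" and lim: "AE x in M. (\<lambda>n. f n x) \<longlonglongrightarrow> g x"
  shows "strongly_measurable M g"
proof -
  have "\<forall>n. \<exists>D. countable D \<and> (AE x in M. f n x \<in> closure D)"
    using f unfolding strongly_measurable_iff_separable_range by blast
  then obtain D where D: "\<And>n. countable (D n)" "\<And>n. AE x in M. f n x \<in> closure (D n)"
    by metis
  have "AE x in M. \<forall>n. f n x \<in> closure (D n)"
    using D(2) by (simp add: AE_all_countable)
  then have "AE x in M. g x \<in> closure (\<Union>n. D n)"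
    using lim
  proof eventually_elim
    case (elim x)
    have "f n x \<in> closure (\<Union>n. D n)" for n
      using elim(1) closure_mono[of "D n" "\<Union>n. D n"] by blast
    then show ?case using elim(2) by (rule closed_sequentially[OF closed_closure])
  qed
  moreover have "g \<in> borel_measurable M"
  proof (rule borel_measurable_LIMSEQ_AE[OF _ lim])
    show "f n \<in> borel_measurable M" for n
      using f[of n] by (simp add: strongly_measurable_iff_separable_range)
  qed
  ultimately show ?thesis
    unfolding strongly_measurable_iff_separable_range using D(1) by (intro conjI exI[of _ "\<Union>n. D n"]) simp_all
qed

lemma continuous_on_imp_strongly_measurable:
  fixes f :: "'a::euclidean_space \<Rightarrow> 'b::metric_space"
  assumes f: "continuous_on S f" and S: "closed S"
  shows "strongly_measurable (lebesgue_on S) f"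
proof -
  have leb: "S \<in> sets lebesgue" using S by (simp add: borel_closed)
  interpret complete_measure "lebesgue_on S" by (rule complete_measure_lebesgue_on[OF leb])
  obtain T where T: "countable T" "T \<subseteq> S" "S \<subseteq> closure T" using separable by blast
  have cl: "closure T = S" using T S by (simp add: closure_minimal subset_antisym)
  have "f ` closure T \<subseteq> closure (f ` T)"
    by (rule image_closure_subset) (use f cl closure_subset[of "f ` T"] in auto)
  then have "AE x in lebesgue_on S. f x \<in> closure (f ` T)"
    using cl by (intro AE_I2) auto
  moreover have "f \<in> borel_measurable (lebesgue_on S)"
    using f leb by (rule continuous_imp_measurable_on_sets_lebesgue)
  ultimately show ?thesis
    unfolding strongly_measurable_iff_separable_range using T(1) by (intro conjI exI[of _ "f ` T"]) simp_all
qed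

section \<open>Inner products\<close>

lemma scaleC_minus_one [simp]: "(-1) *\<^sub>C x = - (x::'a::complex_vector)"
  using scaleR_scaleC[of "-1" x] by simp

lemma cinner_add_left: "cinner (x + y) z = cinner x z + cinner y z"
  by (metis cinner_commute cinner_add_right complex_cnj_add)

lemma cinner_scaleC_left: "cinner (c *\<^sub>C x) y = cnj c * cinner x y"
  by (metis cinner_commute cinner_scaleC_right complex_cnj_mult)

lemma cinner_scaleR_left: "cinner (r *\<^sub>R x) y = complex_of_real r * cinner x y"
  by (simp add: scaleR_scaleC cinner_scaleC_left)

lemma cinner_scaleR_right: "cinner x (r *\<^sub>R y) = complex_of_real r * cinner x y"
  by (simp add: scaleR_scaleC cinner_scaleC_right)

lemma Re_cinner_commute: "Re (cinner x y) = Re (cinner y x)"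
  using cinner_commute[of x y] by simp

lemma norm_add_square_cinner:
  fixes x y :: "'a::chilbert_space"
  shows "(norm (x + y))\<^sup>2 = (norm x)\<^sup>2 + 2 * Re (cinner x y) + (norm y)\<^sup>2"
proof -
  have "Re (cinner (x + y) (x + y)) = Re (cinner x x) + 2 * Re (cinner x y) + Re (cinner y y)"
    using Re_cinner_commute[of x y] by (simp add: cinner_add_left cinner_add_right)
  then show ?thesis by (simp add: cinner_self)
qed

text \<open>Rotating a complex number onto the nonnegative real axis upgrades bounds on real parts
  to bounds on moduli.\<close>

lemma obtain_unimodular:
  obtains c :: complex where "cmod c = 1" "c * z = complex_of_real (cmod z)"
proof (cases "z = 0")
  case False
  then show ?thesis
    by (intro that[of "cnj z / complex_of_real (cmod z)"])
      (simp_all add: norm_divide complex_norm_square[symmetric] mult.commute[of "cnj z"]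
        power2_eq_square field_simps)
qed (use that[of 1] in auto)

text \<open>The usual order is reversed: the triangle inequality belongs to the axioms of the norm,
  so comparing it with the expansion of the squared norm bounds the real part. A unimodular factor
  then gives the modulus.\<close>

lemma cinner_Cauchy_Schwarz:
  fixes x y :: "'a::chilbert_space"
  shows "cmod (cinner x y) \<le> norm x * norm y"
proof -
  have real: "Re (cinner x y) \<le> norm x * norm y" for x y :: 'a
  proof -
    have "(norm (x + y))\<^sup>2 \<le> (norm x + norm y)\<^sup>2"
      by (simp add: norm_triangle_ineq)
    then show ?thesis unfolding norm_add_square_cinner by (simp add: power2_sum)
  qed
  obtain c where c: "cmod c = 1" "c * cinner x y = complex_of_real (cmod (cinner x y))"
    by (rule obtain_unimodular)
  show ?thesis using real[of x "c *\<^sub>C y"] c by (simp add: cinner_scaleC_right norm_scaleC)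
qed

lemma bounded_bilinear_cinner: "bounded_bilinear cinner"
proof
  show "\<exists>K. \<forall>a b. cmod (cinner a b) \<le> norm a * norm b * K"
    by (intro exI[of _ 1]) (simp add: cinner_Cauchy_Schwarz)
qed (simp_all add: cinner_add_left cinner_add_right cinner_scaleR_left cinner_scaleR_right
    scaleR_conv_of_real)

text \<open>The discriminant criterion. It yields Cauchy-Schwarz in L2 and, with
  \<open>a = 0\<close>, the vanishing of the linear coefficient at a minimizer.\<close>

lemma quadratic_nonneg_imp:
  fixes a b c :: real
  assumes nonneg: "\<And>s. 0 \<le> a + 2 * s * b + s\<^sup>2 * c" and "c \<ge> 0"
  shows "b\<^sup>2 \<le> a * c"
proof (cases "c = 0")
  case True
  have "b = 0"
  proof (rule ccontr)
    assume "b \<noteq> 0"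
    \<comment> \<open>For \<open>c = 0\<close> the polynomial is affine, and this argument makes its
      value -1.\<close>
    then have "2 * (- (a + 1) / (2 * b)) * b = - (a + 1)" by (simp add: field_simps)
    then show False using nonneg[of "- (a + 1) / (2 * b)"] True by simp
  qed
  then show ?thesis using True by simp
next
  case False
  with \<open>c \<ge> 0\<close> have c: "c > 0" by simp
  \<comment> \<open>The vertex of the parabola is at \<open>- b / c\<close>.\<close>
  have "a + 2 * (- b / c) * b + (- b / c)\<^sup>2 * c = (a * c - b\<^sup>2) / c"
    using c by (simp add: field_simps power2_eq_square)
  then have "0 \<le> (a * c - b\<^sup>2) / c" using nonneg[of "- b / c"] by simp
  then show ?thesis using c by (simp add: zero_le_divide_iff)
qed

section \<open>The space \<open>L\<^sup>2\<close>\<close>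

lemma complete_lebesgue_on_interval: "complete_measure (lebesgue_on {a..b::real})"
  by (intro complete_measure_lebesgue_on) simp

lemma strongly_measurable_imp_borel:
  fixes f :: "real \<Rightarrow> 'a::metric_space"
  assumes "strongly_measurable (lebesgue_on {a..b}) f"
  shows "f \<in> borel_measurable (lebesgue_on {a..b})"
  using assms complete_measure.strongly_measurable_iff_separable_range[OF complete_lebesgue_on_interval]
  by blast

lemma L2_strongly_measurable: "f \<in> L2 tf \<Longrightarrow> strongly_measurable (lebesgue_on {0..tf}) f"
  by (simp add: L2_def)

lemma L2_integrable_norm_square:
  "f \<in> L2 tf \<Longrightarrow> integrable (lebesgue_on {0..tf}) (\<lambda>t. (norm (f t))\<^sup>2)"
  by (simp add: L2_def)

lemma L2I_bound:
  assumes f: "strongly_measurable (lebesgue_on {0..tf}) f"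
    and g: "integrable (lebesgue_on {0..tf}) g"
    and le: "AE t in lebesgue_on {0..tf}. (norm (f t))\<^sup>2 \<le> g t"
  shows "f \<in> L2 tf"
proof -
  have [measurable]: "f \<in> borel_measurable (lebesgue_on {0..tf})"
    using f by (rule strongly_measurable_imp_borel)
  have "integrable (lebesgue_on {0..tf}) (\<lambda>t. (norm (f t))\<^sup>2)"
    by (rule Bochner_Integration.integrable_bound[OF g]) (measurable, use le in eventually_elim, auto)
  then show ?thesis using f by (simp add: L2_def)
qed

lemma L2_add [intro, simp]:
  assumes f: "f \<in> L2 tf" and g: "g \<in> L2 tf"
  shows "(\<lambda>t. f t + g t) \<in> L2 tf"
proof (rule L2I_bound)
  show "strongly_measurable (lebesgue_on {0..tf}) (\<lambda>t. f t + g t)"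
    using f g by (intro strongly_measurable_compose2[where h = "(+)"] L2_strongly_measurable tendsto_add)
  show "integrable (lebesgue_on {0..tf}) (\<lambda>t. 2 * (norm (f t))\<^sup>2 + 2 * (norm (g t))\<^sup>2)"
    using L2_integrable_norm_square[OF f] L2_integrable_norm_square[OF g] by simp
  have "(norm (x + y))\<^sup>2 \<le> 2 * (norm x)\<^sup>2 + 2 * (norm y)\<^sup>2" for x y :: 'a
  proof -
    have "(norm (x + y))\<^sup>2 \<le> (norm x + norm y)\<^sup>2" by (simp add: norm_triangle_ineq)
    also have "\<dots> \<le> 2 * (norm x)\<^sup>2 + 2 * (norm y)\<^sup>2"
      using zero_le_power2[of "norm x - norm y"] by (simp add: power2_diff power2_sum)
    finally show ?thesis .
  qed
  then show "AE t in lebesgue_on {0..tf}. (norm (f t + g t))\<^sup>2 \<le> 2 * (norm (f t))\<^sup>2 + 2 * (norm (g t))\<^sup>2"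
    by simp
qed

lemma L2_scaleC [intro, simp]:
  assumes f: "f \<in> L2 tf"
  shows "(\<lambda>t. c *\<^sub>C f t) \<in> L2 tf"
proof (rule L2I_bound)
  have "bounded_linear (\<lambda>x::'a. c *\<^sub>C x)"
    by (rule bounded_linear_intro[where K = "cmod c"])
      (simp_all add: scaleC_add_right scaleR_scaleC scaleC_scaleC norm_scaleC mult.commute)
  then show "strongly_measurable (lebesgue_on {0..tf}) (\<lambda>t. c *\<^sub>C f t)"
    using L2_strongly_measurable[OF f]
    by (intro strongly_measurable_compose2[where h = "\<lambda>x y. c *\<^sub>C x"])
      (auto intro: bounded_linear.tendsto)
  show "integrable (lebesgue_on {0..tf}) (\<lambda>t. (cmod c)\<^sup>2 * (norm (f t))\<^sup>2)"
    using f by (auto dest: L2_integrable_norm_square)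
qed (simp add: norm_scaleC power_mult_distrib)

lemma L2_zero [intro, simp]: "(\<lambda>t. 0) \<in> L2 tf"
  by (auto simp: L2_def)

lemma L2_uminus [intro, simp]:
  assumes "f \<in> L2 tf" shows "(\<lambda>t. - f t) \<in> L2 tf"
  using L2_scaleC[OF assms, of "-1"] by simp

lemma L2_diff [intro, simp]:
  assumes "f \<in> L2 tf" "g \<in> L2 tf" shows "(\<lambda>t. f t - g t) \<in> L2 tf"
  using L2_add[OF assms(1) L2_uminus[OF assms(2)]] by simp

lemma L2_scaleR [intro, simp]:
  assumes "f \<in> L2 tf" shows "(\<lambda>t. r *\<^sub>R f t) \<in> L2 tf"
  using L2_scaleC[OF assms] by (simp add: scaleR_scaleC)

lemma L2_integrable_cinner:
  assumes f: "f \<in> L2 tf" and g: "g \<in> L2 tf"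
  shows "integrable (lebesgue_on {0..tf}) (\<lambda>t. cinner (f t) (g t))"
proof (rule Bochner_Integration.integrable_bound)
  show "integrable (lebesgue_on {0..tf}) (\<lambda>t. (norm (f t))\<^sup>2 + (norm (g t))\<^sup>2)"
    using f g by (auto dest: L2_integrable_norm_square)
  show "(\<lambda>t. cinner (f t) (g t)) \<in> borel_measurable (lebesgue_on {0..tf})"
    using f g
    by (intro strongly_measurable_imp_borel strongly_measurable_compose2[where h = cinner]
        L2_strongly_measurable bounded_bilinear.tendsto[OF bounded_bilinear_cinner])
  have "norm (cinner x y) \<le> norm ((norm x)\<^sup>2 + (norm y)\<^sup>2)" for x y :: 'a
  proof -
    have "2 * (norm x * norm y) \<le> (norm x)\<^sup>2 + (norm y)\<^sup>2"
      using zero_le_power2[of "norm x - norm y"] by (simp add: power2_diff)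
    moreover have "0 \<le> norm x * norm y" by simp
    ultimately show ?thesis using cinner_Cauchy_Schwarz[of x y] by (simp del: mult_nonneg_nonneg)
  qed
  then show "AE t in lebesgue_on {0..tf}. norm (cinner (f t) (g t)) \<le> norm ((norm (f t))\<^sup>2 + (norm (g t))\<^sup>2)"
    by simp
qed

section \<open>The inner product of L2 and its Cauchy-Schwarz inequality\<close>

lemma L2_inner_add_right:
  assumes "f \<in> L2 tf" "g \<in> L2 tf" "h \<in> L2 tf"
  shows "L2_inner tf f (\<lambda>t. g t + h t) = L2_inner tf f g + L2_inner tf f h"
  unfolding L2_inner_def using assms by (simp add: cinner_add_right L2_integrable_cinner)

lemma L2_inner_scaleC_right:
  "L2_inner tf f (\<lambda>t. c *\<^sub>C g t) = c * L2_inner tf f g"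
  unfolding L2_inner_def by (simp add: cinner_scaleC_right)

lemma L2_inner_commute: "L2_inner tf f g = cnj (L2_inner tf g f)"
  unfolding L2_inner_def by (subst cinner_commute) simp

lemma L2_inner_add_left:
  assumes "f \<in> L2 tf" "g \<in> L2 tf" "h \<in> L2 tf"
  shows "L2_inner tf (\<lambda>t. g t + h t) f = L2_inner tf g f + L2_inner tf h f"
  using L2_inner_add_right[OF assms] by (metis L2_inner_commute complex_cnj_add)

lemma L2_inner_scaleC_left:
  "L2_inner tf (\<lambda>t. c *\<^sub>C g t) f = cnj c * L2_inner tf g f"
  by (metis L2_inner_commute L2_inner_scaleC_right complex_cnj_mult)

lemma L2_inner_scaleR_right: "L2_inner tf f (\<lambda>t. r *\<^sub>R g t) = complex_of_real r * L2_inner tf f g"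
  by (simp add: scaleR_scaleC L2_inner_scaleC_right)

lemma L2_inner_scaleR_left: "L2_inner tf (\<lambda>t. r *\<^sub>R g t) f = complex_of_real r * L2_inner tf g f"
  by (simp add: scaleR_scaleC L2_inner_scaleC_left)

lemma L2_inner_uminus_right: "L2_inner tf f (\<lambda>t. - g t) = - L2_inner tf f g"
  using L2_inner_scaleC_right[of tf f "-1" g] by simp

lemma L2_inner_uminus_left: "L2_inner tf (\<lambda>t. - g t) f = - L2_inner tf g f"
  using L2_inner_scaleC_left[of tf "-1" g f] by simp

lemma L2_inner_diff_right:
  assumes "f \<in> L2 tf" "g \<in> L2 tf" "h \<in> L2 tf"
  shows "L2_inner tf f (\<lambda>t. g t - h t) = L2_inner tf f g - L2_inner tf f h"
  using L2_inner_add_right[OF assms(1,2) L2_uminus[OF assms(3)]]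
  by (simp add: L2_inner_uminus_right)

lemma L2_inner_diff_left:
  assumes "f \<in> L2 tf" "g \<in> L2 tf" "h \<in> L2 tf"
  shows "L2_inner tf (\<lambda>t. g t - h t) f = L2_inner tf g f - L2_inner tf h f"
  using L2_inner_add_left[OF assms(1,2) L2_uminus[OF assms(3)]]
  by (simp add: L2_inner_uminus_left)

lemmas L2_inner_simps = L2_inner_add_left L2_inner_add_right L2_inner_diff_left
  L2_inner_diff_right L2_inner_scaleR_left L2_inner_scaleR_right L2_inner_uminus_left
  L2_inner_uminus_right

lemma Re_L2_inner_commute: "Re (L2_inner tf f g) = Re (L2_inner tf g f)"
  using L2_inner_commute[of tf f g] by simp

lemma L2_norm_nonneg [simp]: "0 \<le> L2_norm tf f"
  by (simp add: L2_norm_def)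

lemma L2_norm_square: "(L2_norm tf f)\<^sup>2 = integral\<^sup>L (lebesgue_on {0..tf}) (\<lambda>t. (norm (f t))\<^sup>2)"
  by (simp add: L2_norm_def)

lemma L2_inner_self: "L2_inner tf f f = complex_of_real ((L2_norm tf f)\<^sup>2)"
  unfolding L2_inner_def L2_norm_square cinner_self by (rule integral_complex_of_real)

text \<open>No triangle inequality for \<open>L2_norm\<close> is available yet, so the pointwise
  argument cannot be copied. Instead, the discriminant of the squared norm of \<open>f + s h\<close>
  as a polynomial in \<open>s\<close> is used; the triangle inequality then follows.\<close>

lemma L2_Cauchy_Schwarz:
  fixes f g :: "real \<Rightarrow> 'a::chilbert_space"
  assumes f: "f \<in> L2 tf" and g: "g \<in> L2 tf"
  shows "cmod (L2_inner tf f g) \<le> L2_norm tf f * L2_norm tf g"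
proof -
  have real: "\<bar>Re (L2_inner tf f h)\<bar> \<le> L2_norm tf f * L2_norm tf h" if h: "h \<in> L2 tf" for h
  proof -
    have "0 \<le> (L2_norm tf f)\<^sup>2 + 2 * s * Re (L2_inner tf f h) + s\<^sup>2 * (L2_norm tf h)\<^sup>2" for s
    proof -
      have "0 \<le> Re (L2_inner tf (\<lambda>t. f t + s *\<^sub>R h t) (\<lambda>t. f t + s *\<^sub>R h t))"
        by (simp add: L2_inner_self)
      also have "\<dots> = (L2_norm tf f)\<^sup>2 + 2 * s * Re (L2_inner tf f h) + s\<^sup>2 * (L2_norm tf h)\<^sup>2"
        using f h Re_L2_inner_commute[of tf f h]
        by (simp add: L2_inner_simps L2_inner_self[of tf f] L2_inner_self[of tf h] algebra_simps
              power2_eq_square)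
      finally show ?thesis .
    qed
    then have "(Re (L2_inner tf f h))\<^sup>2 \<le> (L2_norm tf f * L2_norm tf h)\<^sup>2"
      using quadratic_nonneg_imp by (simp add: power_mult_distrib)
    then show ?thesis by (simp add: abs_le_square_iff[symmetric] abs_mult)
  qed
  obtain c where c: "cmod c = 1" "c * L2_inner tf f g = complex_of_real (cmod (L2_inner tf f g))"
    by (rule obtain_unimodular)
  have "L2_norm tf (\<lambda>t. c *\<^sub>C g t) = L2_norm tf g"
    using c by (simp add: L2_norm_def norm_scaleC)
  then show ?thesis using real[OF L2_scaleC[OF g, of c]] c by (simp add: L2_inner_scaleC_right)
qed

lemma L2_norm_triangle:
  assumes f: "f \<in> L2 tf" and g: "g \<in> L2 tf"
  shows "L2_norm tf (\<lambda>t. f t + g t) \<le> L2_norm tf f + L2_norm tf g"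
proof (rule power2_le_imp_le)
  have "(L2_norm tf (\<lambda>t. f t + g t))\<^sup>2 = Re (L2_inner tf (\<lambda>t. f t + g t) (\<lambda>t. f t + g t))"
    by (simp add: L2_inner_self)
  also have "\<dots> = (L2_norm tf f)\<^sup>2 + 2 * Re (L2_inner tf f g) + (L2_norm tf g)\<^sup>2"
    using f g Re_L2_inner_commute[of tf f g] by (simp add: L2_inner_simps L2_inner_self[of tf f] L2_inner_self[of tf g])
  also have "\<dots> \<le> (L2_norm tf f + L2_norm tf g)\<^sup>2"
    using L2_Cauchy_Schwarz[OF f g] complex_Re_le_cmod[of "L2_inner tf f g"]
    by (simp add: power2_sum)
  finally show "(L2_norm tf (\<lambda>t. f t + g t))\<^sup>2 \<le> (L2_norm tf f + L2_norm tf g)\<^sup>2" .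
qed simp

section \<open>Equality almost everywhere\<close>

lemma L2_eq_refl [simp]: "L2_eq tf f f"
  by (simp add: L2_eq_def)

lemma L2_eq_sym: "L2_eq tf f g \<Longrightarrow> L2_eq tf g f"
  by (simp add: L2_eq_def eq_commute)

lemma L2_eq_trans [trans]: "L2_eq tf f g \<Longrightarrow> L2_eq tf g h \<Longrightarrow> L2_eq tf f h"
  unfolding L2_eq_def by (erule AE_mp, erule AE_mp) auto

lemma L2_eq_add: "L2_eq tf f f' \<Longrightarrow> L2_eq tf g g' \<Longrightarrow> L2_eq tf (\<lambda>t. f t + g t) (\<lambda>t. f' t + g' t)"
  unfolding L2_eq_def by (erule AE_mp, erule AE_mp) auto

lemma L2_eq_diff: "L2_eq tf f f' \<Longrightarrow> L2_eq tf g g' \<Longrightarrow> L2_eq tf (\<lambda>t. f t - g t) (\<lambda>t. f' t - g' t)"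
  unfolding L2_eq_def by (erule AE_mp, erule AE_mp) auto

lemma L2_eq_scaleC: "L2_eq tf f f' \<Longrightarrow> L2_eq tf (\<lambda>t. c *\<^sub>C f t) (\<lambda>t. c *\<^sub>C f' t)"
  unfolding L2_eq_def by (erule AE_mp) auto

lemma L2_eq_iff_norm_diff:
  assumes f: "f \<in> L2 tf" and g: "g \<in> L2 tf"
  shows "L2_eq tf f g \<longleftrightarrow> L2_norm tf (\<lambda>t. f t - g t) = 0"
proof -
  have "L2_norm tf (\<lambda>t. f t - g t) = 0 \<longleftrightarrow> (AE t in lebesgue_on {0..tf}. (norm (f t - g t))\<^sup>2 = 0)"
    unfolding L2_norm_def real_sqrt_eq_0_iff
    by (rule integral_nonneg_eq_0_iff_AE) (use f g in \<open>auto intro!: L2_integrable_norm_square\<close>)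
  then show ?thesis by (simp add: L2_eq_def)
qed

lemma L2_inner_cong_right:
  assumes "L2_eq tf g g'" "f \<in> L2 tf" "g \<in> L2 tf" "g' \<in> L2 tf"
  shows "L2_inner tf f g = L2_inner tf f g'"
proof -
  have "cmod (L2_inner tf f (\<lambda>t. g t - g' t)) \<le> 0"
    using L2_Cauchy_Schwarz[of f tf "\<lambda>t. g t - g' t"] assms by (simp add: L2_eq_iff_norm_diff)
  then show ?thesis using assms by (simp add: L2_inner_diff_right)
qed

lemma L2_inner_cong_left:
  assumes "L2_eq tf g g'" "f \<in> L2 tf" "g \<in> L2 tf" "g' \<in> L2 tf"
  shows "L2_inner tf g f = L2_inner tf g' f"
  using L2_inner_cong_right[OF assms] by (metis L2_inner_commute)

text \<open>Testing with \<open>v = f - g\<close> gives a zero norm. Identities between operators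
  can thus be proved weakly.\<close>

lemma L2_eqI:
  assumes f: "f \<in> L2 tf" and g: "g \<in> L2 tf"
    and eq: "\<And>v. v \<in> L2 tf \<Longrightarrow> L2_inner tf v f = L2_inner tf v g"
  shows "L2_eq tf f g"
proof -
  have "L2_inner tf (\<lambda>t. f t - g t) (\<lambda>t. f t - g t) = 0"
    using f g eq[of "\<lambda>t. f t - g t"] by (simp add: L2_inner_diff_right)
  then show ?thesis using f g by (simp add: L2_eq_iff_norm_diff L2_inner_self)
qed

section \<open>Completeness of \<open>L\<^sup>2\<close>\<close>

text \<open>Cauchy-Schwarz against the constant 1, which lies in L2 because the interval is bounded.
  The norm is read as a complex function, since \<open>L2\<close> and \<open>L2_inner\<close> take
  values in a complex Hilbert space.\<close>

lemma L2_imp_integrable_norm: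
  fixes f :: "real \<Rightarrow> 'a::chilbert_space"
  assumes f: "f \<in> L2 tf"
  shows "integrable (lebesgue_on {0..tf}) (\<lambda>t. norm (f t))"
    and "integral\<^sup>L (lebesgue_on {0..tf}) (\<lambda>t. norm (f t)) \<le> L2_norm tf (\<lambda>t. 1 :: complex) * L2_norm tf f"
proof -
  let ?g = "\<lambda>t. complex_of_real (norm (f t))"
  have one: "(\<lambda>t. 1 :: complex) \<in> L2 tf"
    by (rule L2I_bound[where g = "\<lambda>t. 1"]) (auto simp: integrable_const_ivl)
  have g: "?g \<in> L2 tf"
  proof (rule L2I_bound)
    show "strongly_measurable (lebesgue_on {0..tf}) ?g"
      using L2_strongly_measurable[OF f]
      by (intro strongly_measurable_compose2[where h = "\<lambda>x y. complex_of_real (norm x)"])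
        (auto intro: tendsto_of_real tendsto_norm)
    show "integrable (lebesgue_on {0..tf}) (\<lambda>t. (norm (f t))\<^sup>2)"
      using f by (rule L2_integrable_norm_square)
  qed simp
  have "integrable (lebesgue_on {0..tf}) ?g"
    using L2_integrable_cinner[OF one g] by (simp add: cinner_complex_def)
  then show int: "integrable (lebesgue_on {0..tf}) (\<lambda>t. norm (f t))"
    by (simp add: complex_of_real_integrable_eq)
  have "L2_inner tf (\<lambda>t. 1) ?g =
      complex_of_real (integral\<^sup>L (lebesgue_on {0..tf}) (\<lambda>t. norm (f t)))"
    by (simp add: L2_inner_def cinner_complex_def)
  then have "cmod (L2_inner tf (\<lambda>t. 1) ?g) = integral\<^sup>L (lebesgue_on {0..tf}) (\<lambda>t. norm (f t))"
    by (simp add: integral_nonneg_AE)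
  moreover have "L2_norm tf ?g = L2_norm tf f" by (simp add: L2_norm_def)
  ultimately show "integral\<^sup>L (lebesgue_on {0..tf}) (\<lambda>t. norm (f t)) \<le>
      L2_norm tf (\<lambda>t. 1 :: complex) * L2_norm tf f"
    using L2_Cauchy_Schwarz[OF one g] by simp
qed

lemma L2_norm_telescope:
  assumes u: "\<And>n. u n \<in> L2 tf" and "n \<le> m"
  shows "L2_norm tf (\<lambda>t. u m t - u n t) \<le> (\<Sum>k=n..<m. L2_norm tf (\<lambda>t. u (Suc k) t - u k t))"
  using \<open>n \<le> m\<close>
proof (induction m rule: dec_induct)
  case base
  then show ?case by (simp add: L2_norm_def)
next
  case (step m)
  have "L2_norm tf (\<lambda>t. (u (Suc m) t - u m t) + (u m t - u n t)) \<le>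
      L2_norm tf (\<lambda>t. u (Suc m) t - u m t) + L2_norm tf (\<lambda>t. u m t - u n t)"
    using u by (intro L2_norm_triangle) auto
  then show ?case using step by simp
qed

text \<open>The core of Riesz-Fischer. Summable steps in L2 are summable in L1, so the telescoping
  series converges absolutely almost everywhere; Fatou's lemma turns pointwise into norm
  convergence. Summability of the steps is what the minimising sequences below provide.\<close>

lemma L2_complete:
  fixes u :: "nat \<Rightarrow> real \<Rightarrow> 'a::chilbert_space"
  assumes u: "\<And>n. u n \<in> L2 tf"
    and sum: "summable (\<lambda>n. L2_norm tf (\<lambda>t. u (Suc n) t - u n t))"
  obtains v where "v \<in> L2 tf" "(\<lambda>n. L2_norm tf (\<lambda>t. u n t - v t)) \<longlonglongrightarrow> 0"
proof -
  let ?M = "lebesgue_on {0..tf}"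
  interpret complete_measure ?M by (rule complete_lebesgue_on_interval)
  define a where "a n = L2_norm tf (\<lambda>t. u (Suc n) t - u n t)" for n
  define d where "d n t = norm (u (Suc n) t - u n t)" for n t
  have d_int: "integrable ?M (d n)"
    and d_le: "integral\<^sup>L ?M (d n) \<le> L2_norm tf (\<lambda>t. 1 :: complex) * a n" for n
    unfolding d_def a_def using u by (auto intro: L2_imp_integrable_norm)
  have d_nonneg: "0 \<le> d n t" for n t by (simp add: d_def)
  have [measurable]: "d n \<in> borel_measurable ?M" for n using d_int by auto
  have "summable (\<lambda>n. integral\<^sup>L ?M (d n))"
  proof (rule summable_comparison_test_ev)
    show "summable (\<lambda>n. L2_norm tf (\<lambda>t. 1 :: complex) * a n)"
      using sum by (simp add: a_def summable_mult)
    show "\<forall>\<^sub>F n in sequentially. norm (integral\<^sup>L ?M (d n)) \<le> L2_norm tf (\<lambda>t. 1 :: complex) * a n"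
      using d_le d_nonneg by (intro always_eventually) (simp add: integral_nonneg_AE)
  qed
  \<comment> \<open>In \<open>ennreal\<close> sum and integral may be exchanged at once, and a
    finite integral forces a finite integrand almost everywhere.\<close>
  then have "(\<Sum>n. ennreal (integral\<^sup>L ?M (d n))) \<noteq> top"
    by (rule ennreal_suminf_neq_top) (simp add: d_nonneg integral_nonneg_AE)
  then have "(\<integral>\<^sup>+t. (\<Sum>n. ennreal (d n t)) \<partial>?M) \<noteq> top"
    by (subst nn_integral_suminf) (simp_all add: nn_integral_eq_integral d_int d_nonneg)
  then have "AE t in ?M. (\<Sum>n. ennreal (d n t)) \<noteq> top"
    using nn_integral_PInf_AE[of "\<lambda>t. \<Sum>n. ennreal (d n t)" ?M] by (simp add: infinity_ennreal_def)
  then have ae_sum: "AE t in ?M. summable (\<lambda>n. u (Suc n) t - u n t)"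
  proof eventually_elim
    case (elim t)
    then have "summable (\<lambda>n. d n t)" using d_nonneg by (intro summable_suminf_not_top)
    then show ?case unfolding d_def by (rule summable_norm_cancel)
  qed
  \<comment> \<open>Where the series diverges the value is arbitrary; these points form a null
    set.\<close>
  define v where "v t = (\<Sum>n. u (Suc n) t - u n t) + u 0 t" for t
  have lim: "AE t in ?M. (\<lambda>n. u n t) \<longlonglongrightarrow> v t"
    using ae_sum
  proof eventually_elim
    case (elim t)
    have "(\<lambda>n. (\<Sum>k<n. u (Suc k) t - u k t) + u 0 t) \<longlonglongrightarrow> v t"
      unfolding v_def by (intro tendsto_add summable_LIMSEQ[OF elim] tendsto_const)
    then show ?case by (simp add: sum_lessThan_telescope[of "\<lambda>k. u k t"])
  qed
  have sm: "strongly_measurable ?M v"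
    using L2_strongly_measurable[OF u] lim by (rule strongly_measurable_LIMSEQ)
  have sm_diff: "strongly_measurable ?M (\<lambda>t. u n t - v t)" for n
    using L2_strongly_measurable[OF u] sm
    by (intro strongly_measurable_compose2[where h = "(-)"] tendsto_diff)
  \<comment> \<open>The tail of the series of step norms bounds the distance from \<open>u n\<close>
    to every later member.\<close>
  define r where "r n = suminf a - sum a {..<n}" for n
  have a: "summable a" using sum by (simp add: a_def[abs_def])
  have a_nonneg: "0 \<le> a n" for n by (simp add: a_def)
  have dist_le: "L2_norm tf (\<lambda>t. u n t - u m t) \<le> r n" if "n \<le> m" for n m
  proof -
    have "L2_norm tf (\<lambda>t. u n t - u m t) = L2_norm tf (\<lambda>t. u m t - u n t)"
      unfolding L2_norm_def by (simp add: norm_minus_commute)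
    also have "\<dots> \<le> sum a {n..<m}"
      using L2_norm_telescope[of u tf, OF u that] by (simp add: a_def)
    also have "\<dots> = sum a {..<m} - sum a {..<n}"
      using that by (simp add: sum_diff_nat_ivl lessThan_atLeast0)
    also have "\<dots> \<le> r n"
      unfolding r_def using sum_le_suminf[OF a, of "{..<m}"] a_nonneg by simp
    finally show ?thesis .
  qed
  have r_nonneg: "0 \<le> r n" for n
    using dist_le[of n n] by (simp add: L2_norm_def)
  have fatou: "(\<integral>\<^sup>+t. ennreal ((norm (u n t - v t))\<^sup>2) \<partial>?M) \<le> ennreal ((r n)\<^sup>2)" for n
  proof -
    have u_diff: "(\<lambda>t. u n t - u m t) \<in> L2 tf" for m using u by auto
    have "(\<integral>\<^sup>+t. ennreal ((norm (u n t - v t))\<^sup>2) \<partial>?M) =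
        (\<integral>\<^sup>+t. liminf (\<lambda>m. ennreal ((norm (u n t - u m t))\<^sup>2)) \<partial>?M)"
    proof (rule nn_integral_cong_AE, use lim in eventually_elim)
      case (elim t)
      have "(\<lambda>m. ennreal ((norm (u n t - u m t))\<^sup>2)) \<longlonglongrightarrow> ennreal ((norm (u n t - v t))\<^sup>2)"
        by (intro tendsto_intros tendsto_ennrealI elim)
      then show ?case by (rule lim_imp_Liminf[OF trivial_limit_sequentially, symmetric])
    qed
    also have "\<dots> \<le> liminf (\<lambda>m. \<integral>\<^sup>+t. ennreal ((norm (u n t - u m t))\<^sup>2) \<partial>?M)"
      using L2_integrable_norm_square[OF u_diff]
      by (intro nn_integral_liminf measurable_compose[OF _ measurable_ennreal]
          borel_measurable_integrable)
    also have "\<dots> \<le> ennreal ((r n)\<^sup>2)"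
    proof (rule Liminf_le[OF sequentially_bot], rule eventually_sequentiallyI)
      fix m assume "n \<le> m"
      then have "(L2_norm tf (\<lambda>t. u n t - u m t))\<^sup>2 \<le> (r n)\<^sup>2"
        by (intro power_mono dist_le) auto
      then show "(\<integral>\<^sup>+t. ennreal ((norm (u n t - u m t))\<^sup>2) \<partial>?M) \<le> ennreal ((r n)\<^sup>2)"
        using L2_integrable_norm_square[OF u_diff, of m]
        by (simp add: nn_integral_eq_integral L2_norm_square)
    qed
    finally show ?thesis .
  qed
  have meas: "(\<lambda>t. (norm (u n t - v t))\<^sup>2) \<in> borel_measurable ?M" for n
    using strongly_measurable_imp_borel[OF sm_diff[of n]] by measurable
  have int: "integrable ?M (\<lambda>t. (norm (u n t - v t))\<^sup>2)" for n
  proof (rule integrableI_nonneg[OF meas])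
    show "(\<integral>\<^sup>+t. ennreal ((norm (u n t - v t))\<^sup>2) \<partial>?M) < \<infinity>"
      using fatou[of n] by (rule order.strict_trans1) (simp add: infinity_ennreal_def)
  qed simp
  have diff: "(\<lambda>t. u n t - v t) \<in> L2 tf" for n
    using sm_diff int by (simp add: L2_def)
  show ?thesis
  proof
    \<comment> \<open>Here \<open>v\<close> is written as \<open>u 0 - (u 0 - v)\<close>.\<close>
    show "v \<in> L2 tf" using L2_diff[OF u diff, of 0 0] by simp
    have le: "L2_norm tf (\<lambda>t. u n t - v t) \<le> r n" for n
    proof (rule power2_le_imp_le)
      show "(L2_norm tf (\<lambda>t. u n t - v t))\<^sup>2 \<le> (r n)\<^sup>2"
        using fatou[of n] int[of n] by (simp add: nn_integral_eq_integral L2_norm_square)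
    qed (rule r_nonneg)
    have "r \<longlonglongrightarrow> suminf a - suminf a"
      unfolding r_def[abs_def] by (intro tendsto_diff tendsto_const summable_LIMSEQ a)
    then have r0: "r \<longlonglongrightarrow> 0" by simp
    show "(\<lambda>n. L2_norm tf (\<lambda>t. u n t - v t)) \<longlonglongrightarrow> 0"
      by (rule Lim_null_comparison[OF always_eventually r0]) (simp add: le)
  qed
qed

section \<open>Bounded operators on \<open>L\<^sup>2\<close>\<close>

lemma L2_bounded_operator_closed:
  "L2_bounded_operator tf S \<Longrightarrow> u \<in> L2 tf \<Longrightarrow> S u \<in> L2 tf"
  by (simp add: L2_bounded_operator_def)

lemma L2_bounded_operator_add:
  "L2_bounded_operator tf S \<Longrightarrow> u \<in> L2 tf \<Longrightarrow> v \<in> L2 tf \<Longrightarrow>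
    L2_eq tf (S (\<lambda>t. u t + v t)) (\<lambda>t. S u t + S v t)"
  by (simp add: L2_bounded_operator_def)

lemma L2_bounded_operator_scaleC:
  "L2_bounded_operator tf S \<Longrightarrow> u \<in> L2 tf \<Longrightarrow> L2_eq tf (S (\<lambda>t. c *\<^sub>C u t)) (\<lambda>t. c *\<^sub>C S u t)"
  by (simp add: L2_bounded_operator_def)

lemma L2_bounded_operator_scaleR:
  "L2_bounded_operator tf S \<Longrightarrow> u \<in> L2 tf \<Longrightarrow> L2_eq tf (S (\<lambda>t. r *\<^sub>R u t)) (\<lambda>t. r *\<^sub>R S u t)"
  unfolding scaleR_scaleC by (rule L2_bounded_operator_scaleC)

lemma L2_bounded_operator_uminus:
  "L2_bounded_operator tf S \<Longrightarrow> u \<in> L2 tf \<Longrightarrow> L2_eq tf (S (\<lambda>t. - u t)) (\<lambda>t. - S u t)"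
  using L2_bounded_operator_scaleC[of tf S u "-1"] by simp

lemma L2_bounded_operator_diff:
  assumes S: "L2_bounded_operator tf S" and "u \<in> L2 tf" "v \<in> L2 tf"
  shows "L2_eq tf (S (\<lambda>t. u t - v t)) (\<lambda>t. S u t - S v t)"
proof -
  have "L2_eq tf (S (\<lambda>t. u t + - v t)) (\<lambda>t. S u t + S (\<lambda>t. - v t) t)"
    using assms by (intro L2_bounded_operator_add) auto
  also have "L2_eq tf \<dots> (\<lambda>t. S u t + - S v t)"
    using assms by (intro L2_eq_add L2_bounded_operator_uminus) auto
  finally show ?thesis by simp
qed

lemma L2_bounded_operator_bound:
  assumes "L2_bounded_operator tf S"
  obtains K where "K \<ge> 0" "\<And>u. u \<in> L2 tf \<Longrightarrow> L2_norm tf (S u) \<le> K * L2_norm tf u"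
proof -
  obtain K where K: "\<And>u. u \<in> L2 tf \<Longrightarrow> L2_norm tf (S u) \<le> K * L2_norm tf u"
    using assms unfolding L2_bounded_operator_def by blast
  have "L2_norm tf (S u) \<le> max K 0 * L2_norm tf u" if "u \<in> L2 tf" for u
    using K[OF that] mult_right_mono[of K "max K 0" "L2_norm tf u"] by simp
  then show ?thesis using that[of "max K 0"] by simp
qed

text \<open>Being well defined on classes is derived: the difference of the arguments has norm zero,
  and boundedness passes this on to its image.\<close>

lemma L2_bounded_operator_cong:
  assumes S: "L2_bounded_operator tf S" and u: "u \<in> L2 tf" and v: "v \<in> L2 tf"
    and eq: "L2_eq tf u v"
  shows "L2_eq tf (S u) (S v)"
proof -
  obtain K where K: "\<And>u. u \<in> L2 tf \<Longrightarrow> L2_norm tf (S u) \<le> K * L2_norm tf u"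
    using L2_bounded_operator_bound[OF S] by metis
  have d: "(\<lambda>t. u t - v t) \<in> L2 tf" using u v by auto
  have "L2_norm tf (S (\<lambda>t. u t - v t)) = 0"
    using K[OF d] eq u v by (simp add: L2_eq_iff_norm_diff antisym)
  then have "L2_eq tf (S (\<lambda>t. u t - v t)) (\<lambda>t. 0)"
    using L2_bounded_operator_closed[OF S d] by (simp add: L2_eq_iff_norm_diff)
  with L2_eq_sym[OF L2_bounded_operator_diff[OF S u v]]
  have "L2_eq tf (\<lambda>t. S u t - S v t) (\<lambda>t. 0)" by (rule L2_eq_trans)
  then show ?thesis by (simp add: L2_eq_def)
qed

lemma L2_bounded_operator_id: "L2_bounded_operator tf (\<lambda>u. u)"
  unfolding L2_bounded_operator_def by (auto intro: exI[of _ 1])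

text \<open>Meant for the feedback operator, which agrees only almost everywhere with a composition
  of bounded operators.\<close>

lemma L2_bounded_operator_transfer:
  fixes S T :: "(real \<Rightarrow> 'a::chilbert_space) \<Rightarrow> real \<Rightarrow> 'b::chilbert_space"
  assumes S: "L2_bounded_operator tf S"
    and T: "\<And>u. u \<in> L2 tf \<Longrightarrow> T u \<in> L2 tf" "\<And>u. u \<in> L2 tf \<Longrightarrow> L2_eq tf (T u) (S u)"
  shows "L2_bounded_operator tf T"
  unfolding L2_bounded_operator_def
proof (intro conjI ballI allI)
  fix u v :: "real \<Rightarrow> 'a" assume uv: "u \<in> L2 tf" "v \<in> L2 tf"
  show "T u \<in> L2 tf" by (rule T(1)) fact
  have "L2_eq tf (T (\<lambda>t. u t + v t)) (S (\<lambda>t. u t + v t))" using uv by (intro T(2)) auto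
  also have "L2_eq tf \<dots> (\<lambda>t. S u t + S v t)" using S uv by (intro L2_bounded_operator_add)
  also have "L2_eq tf \<dots> (\<lambda>t. T u t + T v t)" using uv by (intro L2_eq_add L2_eq_sym[OF T(2)])
  finally show "L2_eq tf (T (\<lambda>t. u t + v t)) (\<lambda>t. T u t + T v t)" .
next
  fix c and u :: "real \<Rightarrow> 'a" assume u: "u \<in> L2 tf"
  have "L2_eq tf (T (\<lambda>t. c *\<^sub>C u t)) (S (\<lambda>t. c *\<^sub>C u t))" using u by (intro T(2)) auto
  also have "L2_eq tf \<dots> (\<lambda>t. c *\<^sub>C S u t)" using S u by (intro L2_bounded_operator_scaleC)
  also have "L2_eq tf \<dots> (\<lambda>t. c *\<^sub>C T u t)" using u by (intro L2_eq_scaleC L2_eq_sym[OF T(2)])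
  finally show "L2_eq tf (T (\<lambda>t. c *\<^sub>C u t)) (\<lambda>t. c *\<^sub>C T u t)" .
next
  have "L2_norm tf (T u) = L2_norm tf (S u)" if u: "u \<in> L2 tf" for u
  proof -
    have mem: "T u \<in> L2 tf" "S u \<in> L2 tf"
      using T(1)[OF u] L2_bounded_operator_closed[OF S u] by auto
    have "L2_inner tf (T u) (T u) = L2_inner tf (S u) (T u)"
      using T(2)[OF u] mem by (intro L2_inner_cong_left) auto
    also have "\<dots> = L2_inner tf (S u) (S u)"
      using T(2)[OF u] mem by (intro L2_inner_cong_right) auto
    finally have "(L2_norm tf (T u))\<^sup>2 = (L2_norm tf (S u))\<^sup>2"
      unfolding L2_inner_self of_real_eq_iff .
    then show ?thesis by (simp add: power2_eq_iff_nonneg)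
  qed
  then show "\<exists>K. \<forall>u\<in>L2 tf. L2_norm tf (T u) \<le> K * L2_norm tf u"
    using S unfolding L2_bounded_operator_def by auto
qed

lemma L2_bounded_operator_compose:
  fixes S :: "(real \<Rightarrow> 'b::chilbert_space) \<Rightarrow> real \<Rightarrow> 'c::chilbert_space"
    and T :: "(real \<Rightarrow> 'a::chilbert_space) \<Rightarrow> real \<Rightarrow> 'b"
  assumes S: "L2_bounded_operator tf S" and T: "L2_bounded_operator tf T"
  shows "L2_bounded_operator tf (\<lambda>u. S (T u))"
  unfolding L2_bounded_operator_def
proof (intro conjI ballI allI)
  note closed = L2_bounded_operator_closed[OF S] L2_bounded_operator_closed[OF T]
  fix u v :: "real \<Rightarrow> 'a" assume uv: "u \<in> L2 tf" "v \<in> L2 tf"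
  show "S (T u) \<in> L2 tf" using uv by (intro closed)
  have "L2_eq tf (S (T (\<lambda>t. u t + v t))) (S (\<lambda>t. T u t + T v t))"
    using uv closed by (intro L2_bounded_operator_cong[OF S] L2_bounded_operator_add[OF T]) auto
  also have "L2_eq tf \<dots> (\<lambda>t. S (T u) t + S (T v) t)"
    using uv closed by (intro L2_bounded_operator_add[OF S]) auto
  finally show "L2_eq tf (S (T (\<lambda>t. u t + v t))) (\<lambda>t. S (T u) t + S (T v) t)" .
next
  note closed = L2_bounded_operator_closed[OF S] L2_bounded_operator_closed[OF T]
  fix c and u :: "real \<Rightarrow> 'a" assume u: "u \<in> L2 tf"
  have "L2_eq tf (S (T (\<lambda>t. c *\<^sub>C u t))) (S (\<lambda>t. c *\<^sub>C T u t))"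
    using u closed by (intro L2_bounded_operator_cong[OF S] L2_bounded_operator_scaleC[OF T]) auto
  also have "L2_eq tf \<dots> (\<lambda>t. c *\<^sub>C S (T u) t)"
    using u closed by (intro L2_bounded_operator_scaleC[OF S]) auto
  finally show "L2_eq tf (S (T (\<lambda>t. c *\<^sub>C u t))) (\<lambda>t. c *\<^sub>C S (T u) t)" .
next
  obtain K where K: "K \<ge> 0" "\<And>u. u \<in> L2 tf \<Longrightarrow> L2_norm tf (S u) \<le> K * L2_norm tf u"
    using L2_bounded_operator_bound[OF S] by metis
  obtain L where L: "L \<ge> 0" "\<And>u. u \<in> L2 tf \<Longrightarrow> L2_norm tf (T u) \<le> L * L2_norm tf u"
    using L2_bounded_operator_bound[OF T] by metis
  have "L2_norm tf (S (T u)) \<le> (K * L) * L2_norm tf u" if u: "u \<in> L2 tf" for u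
    using K(2)[OF L2_bounded_operator_closed[OF T u]] mult_left_mono[OF L(2)[OF u] K(1)]
    by (simp add: mult.assoc)
  then show "\<exists>K. \<forall>u\<in>L2 tf. L2_norm tf (S (T u)) \<le> K * L2_norm tf u" by blast
qed

lemma L2_bounded_operator_sum:
  fixes S T :: "(real \<Rightarrow> 'a::chilbert_space) \<Rightarrow> real \<Rightarrow> 'b::chilbert_space"
  assumes S: "L2_bounded_operator tf S" and T: "L2_bounded_operator tf T"
  shows "L2_bounded_operator tf (\<lambda>u t. S u t + T u t)"
  unfolding L2_bounded_operator_def
proof (intro conjI ballI allI)
  note closed = L2_bounded_operator_closed[OF S] L2_bounded_operator_closed[OF T]
  fix u v :: "real \<Rightarrow> 'a" assume uv: "u \<in> L2 tf" "v \<in> L2 tf"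
  show "(\<lambda>t. S u t + T u t) \<in> L2 tf" using uv closed by auto
  show "L2_eq tf (\<lambda>t. S (\<lambda>t. u t + v t) t + T (\<lambda>t. u t + v t) t)
      (\<lambda>t. S u t + T u t + (S v t + T v t))"
    using L2_eq_add[OF L2_bounded_operator_add[OF S uv] L2_bounded_operator_add[OF T uv]]
    by (simp add: add_ac)
next
  fix c and u :: "real \<Rightarrow> 'a" assume u: "u \<in> L2 tf"
  show "L2_eq tf (\<lambda>t. S (\<lambda>t. c *\<^sub>C u t) t + T (\<lambda>t. c *\<^sub>C u t) t) (\<lambda>t. c *\<^sub>C (S u t + T u t))"
    using L2_eq_add[OF L2_bounded_operator_scaleC[OF S u] L2_bounded_operator_scaleC[OF T u]]
    by (simp add: scaleC_add_right)
next
  obtain K where K: "\<And>u. u \<in> L2 tf \<Longrightarrow> L2_norm tf (S u) \<le> K * L2_norm tf u"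
    using L2_bounded_operator_bound[OF S] by metis
  obtain L where L: "\<And>u. u \<in> L2 tf \<Longrightarrow> L2_norm tf (T u) \<le> L * L2_norm tf u"
    using L2_bounded_operator_bound[OF T] by metis
  have "L2_norm tf (\<lambda>t. S u t + T u t) \<le> (K + L) * L2_norm tf u" if u: "u \<in> L2 tf" for u
    using L2_norm_triangle[OF L2_bounded_operator_closed[OF S u] L2_bounded_operator_closed[OF T u]]
      K[OF u] L[OF u] by (simp add: algebra_simps)
  then show "\<exists>K. \<forall>u\<in>L2 tf. L2_norm tf (\<lambda>t. S u t + T u t) \<le> K * L2_norm tf u" by blast
qed

text \<open>Linearity of \<open>T\<close> is a consequence of the adjoint relation.\<close>

lemma L2_bounded_operatorI_adjoint:
  fixes S :: "(real \<Rightarrow> 'b::chilbert_space) \<Rightarrow> real \<Rightarrow> 'a::chilbert_space"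
    and T :: "(real \<Rightarrow> 'a) \<Rightarrow> real \<Rightarrow> 'b"
  assumes S: "\<And>v. v \<in> L2 tf \<Longrightarrow> S v \<in> L2 tf" and T: "\<And>u. u \<in> L2 tf \<Longrightarrow> T u \<in> L2 tf"
    and adj: "\<And>u v. u \<in> L2 tf \<Longrightarrow> v \<in> L2 tf \<Longrightarrow> L2_inner tf (S v) u = L2_inner tf v (T u)"
    and bound: "\<And>u. u \<in> L2 tf \<Longrightarrow> L2_norm tf (T u) \<le> K * L2_norm tf u"
  shows "L2_bounded_operator tf T"
  unfolding L2_bounded_operator_def
proof (intro conjI ballI allI)
  fix u v :: "real \<Rightarrow> 'a" assume uv: "u \<in> L2 tf" "v \<in> L2 tf"
  show "T u \<in> L2 tf" by (rule T) fact
  show "L2_eq tf (T (\<lambda>t. u t + v t)) (\<lambda>t. T u t + T v t)"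
  proof (rule L2_eqI)
    fix w :: "real \<Rightarrow> 'b" assume w: "w \<in> L2 tf"
    show "L2_inner tf w (T (\<lambda>t. u t + v t)) = L2_inner tf w (\<lambda>t. T u t + T v t)"
      using uv w S T by (simp add: adj[symmetric] L2_inner_add_right)
  qed (use uv T in auto)
next
  fix c and u :: "real \<Rightarrow> 'a" assume u: "u \<in> L2 tf"
  show "L2_eq tf (T (\<lambda>t. c *\<^sub>C u t)) (\<lambda>t. c *\<^sub>C T u t)"
  proof (rule L2_eqI)
    fix w :: "real \<Rightarrow> 'b" assume w: "w \<in> L2 tf"
    show "L2_inner tf w (T (\<lambda>t. c *\<^sub>C u t)) = L2_inner tf w (\<lambda>t. c *\<^sub>C T u t)"
      using u w by (simp add: adj[symmetric] L2_inner_scaleC_right)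
  qed (use u T in auto)
qed (use bound in auto)

section \<open>Self-adjoint operators and minimisation of quadratic functionals\<close>

definition L2_selfadjoint :: "real \<Rightarrow> ((real \<Rightarrow> 'a::chilbert_space) \<Rightarrow> real \<Rightarrow> 'a) \<Rightarrow> bool" where
  "L2_selfadjoint tf S \<longleftrightarrow> L2_bounded_operator tf S \<and>
    (\<forall>u\<in>L2 tf. \<forall>v\<in>L2 tf. L2_inner tf (S u) v = L2_inner tf u (S v))"

lemma L2_selfadjoint_bounded: "L2_selfadjoint tf S \<Longrightarrow> L2_bounded_operator tf S"
  by (simp add: L2_selfadjoint_def)

lemma L2_selfadjoint_inner:
  "L2_selfadjoint tf S \<Longrightarrow> u \<in> L2 tf \<Longrightarrow> v \<in> L2 tf \<Longrightarrow> L2_inner tf (S u) v = L2_inner tf u (S v)"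
  by (simp add: L2_selfadjoint_def)

text \<open>The point \<open>w\<close> is tied to \<open>u + s v\<close> only almost everywhere,
  because the output of a perturbed control is a perturbed output only up to a null set.\<close>

lemma L2_quadratic_form_expand:
  assumes S: "L2_selfadjoint tf S" and u: "u \<in> L2 tf" and v: "v \<in> L2 tf"
    and w: "w \<in> L2 tf" "L2_eq tf w (\<lambda>t. u t + s *\<^sub>R v t)"
  shows "Re (L2_inner tf w (S w)) =
    Re (L2_inner tf u (S u)) + 2 * s * Re (L2_inner tf v (S u)) + s\<^sup>2 * Re (L2_inner tf v (S v))"
proof -
  note B = L2_selfadjoint_bounded[OF S]
  note closed = L2_bounded_operator_closed[OF B]
  let ?w = "\<lambda>t. u t + s *\<^sub>R v t" and ?Sw = "\<lambda>t. S u t + s *\<^sub>R S v t"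
  have mem: "?w \<in> L2 tf" "?Sw \<in> L2 tf" "S w \<in> L2 tf" "S u \<in> L2 tf" "S v \<in> L2 tf"
    using u v w closed by auto
  have "L2_eq tf (S w) (S ?w)"
    using mem w by (intro L2_bounded_operator_cong[OF B]) auto
  also have "L2_eq tf \<dots> (\<lambda>t. S u t + S (\<lambda>t. s *\<^sub>R v t) t)"
    using u v by (intro L2_bounded_operator_add[OF B]) auto
  also have "L2_eq tf \<dots> ?Sw"
    using u v by (intro L2_eq_add L2_bounded_operator_scaleR[OF B]) auto
  finally have eq: "L2_eq tf (S w) ?Sw" .
  have "L2_inner tf w (S w) = L2_inner tf ?w (S w)"
    using mem w by (intro L2_inner_cong_left) auto
  also have "\<dots> = L2_inner tf ?w ?Sw"
    using mem eq by (intro L2_inner_cong_right) auto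
  finally have "Re (L2_inner tf w (S w)) = Re (L2_inner tf ?w ?Sw)" by simp
  moreover have "Re (L2_inner tf u (S v)) = Re (L2_inner tf v (S u))"
    using L2_selfadjoint_inner[OF S u v] Re_L2_inner_commute[of tf "S u" v] by simp
  ultimately show ?thesis
    using mem u v by (simp add: L2_inner_simps algebra_simps power2_eq_square)
qed

text \<open>The vector \<open>u\<close> is found by minimising \<open>J v = \<langle>v, S v\<rangle> - 2 Re (\<phi> v)\<close>: coercivity bounds \<open>J\<close>
  from below and, by the parallelogram identity, makes minimising sequences Cauchy.\<close>

lemma L2_Lax_Milgram_selfadjoint:
  fixes S :: "(real \<Rightarrow> 'a::chilbert_space) \<Rightarrow> real \<Rightarrow> 'a"
  assumes S: "L2_selfadjoint tf S" and coercive: "L2_coercive tf S"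
    and add: "\<And>u v. u \<in> L2 tf \<Longrightarrow> v \<in> L2 tf \<Longrightarrow> \<phi> (\<lambda>t. u t + v t) = \<phi> u + \<phi> v"
    and scale: "\<And>c u. u \<in> L2 tf \<Longrightarrow> \<phi> (\<lambda>t. c *\<^sub>C u t) = c * \<phi> u"
    and bound: "\<And>u. u \<in> L2 tf \<Longrightarrow> cmod (\<phi> u) \<le> K * L2_norm tf u"
  obtains u where "u \<in> L2 tf" "\<And>v. v \<in> L2 tf \<Longrightarrow> \<phi> v = L2_inner tf (S u) v"
proof -
  note closed = L2_bounded_operator_closed[OF L2_selfadjoint_bounded[OF S]]
  obtain \<epsilon> where \<epsilon>: "\<epsilon> > 0"
    and coer: "\<And>u. u \<in> L2 tf \<Longrightarrow> \<epsilon> * (L2_norm tf u)\<^sup>2 \<le> Re (L2_inner tf u (S u))"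
    using coercive unfolding L2_coercive_def by blast
  define q where "q u = Re (L2_inner tf u (S u))" for u
  \<comment> \<open>Half the directional derivative of \<open>J\<close> at \<open>u\<close> along
    \<open>v\<close>.\<close>
  define b where "b u v = Re (L2_inner tf v (S u)) - Re (\<phi> v)" for u v
  define J where "J u = q u - 2 * Re (\<phi> u)" for u
  have expand: "J (\<lambda>t. u t + s *\<^sub>R v t) = J u + 2 * s * b u v + s\<^sup>2 * q v"
    if "u \<in> L2 tf" "v \<in> L2 tf" for u v s
    using that L2_quadratic_form_expand[OF S that, of "\<lambda>t. u t + s *\<^sub>R v t" s]
    by (simp add: J_def q_def b_def add scale scaleR_scaleC algebra_simps)
  have q_nonneg: "0 \<le> q u" if "u \<in> L2 tf" for u
    using coer[OF that] \<epsilon> by (intro order_trans[OF _ coer[OF that, folded q_def]]) simp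
  have lower: "- (K\<^sup>2 / \<epsilon>) \<le> J u" if u: "u \<in> L2 tf" for u
  proof -
    \<comment> \<open>Completing the square gives the lower bound
      \<open>- (K\<^sup>2 / \<epsilon>)\<close>.\<close>
    have "0 \<le> (\<epsilon> * L2_norm tf u - K)\<^sup>2 / \<epsilon>" using \<epsilon> by simp
    also have "\<dots> = \<epsilon> * (L2_norm tf u)\<^sup>2 - 2 * (K * L2_norm tf u) + K\<^sup>2 / \<epsilon>"
      using \<epsilon> by (simp add: power2_eq_square field_simps)
    finally show ?thesis
      using coer[OF u] bound[OF u] complex_Re_le_cmod[of "\<phi> u"] by (simp add: J_def q_def)
  qed
  define m where "m = Inf (J ` L2 tf)"
  have bdd: "bdd_below (J ` L2 tf)" using lower by (intro bdd_belowI2[of _ "- (K\<^sup>2 / \<epsilon>)"])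
  have m_le: "m \<le> J u" if "u \<in> L2 tf" for u
    unfolding m_def using bdd that by (intro cInf_lower) auto
  \<comment> \<open>An excess of order \<open>(1/4) ^ n\<close> in \<open>J\<close> gives steps of
    order \<open>(1/2) ^ n\<close> in norm, hence summable ones.\<close>
  have "\<exists>u\<in>L2 tf. J u < m + (1/4) ^ n" for n
  proof -
    have "L2 tf \<noteq> ({} :: (real \<Rightarrow> 'a) set)" using L2_zero by blast
    then show ?thesis
      using cInf_lessD[of "J ` L2 tf" "m + (1/4) ^ n"] by (auto simp: m_def)
  qed
  then obtain u where u: "\<And>n. u n \<in> L2 tf" and u_less: "\<And>n. J (u n) < m + (1/4) ^ n"
    by metis
  define d where "d n = (\<lambda>t. u (Suc n) t - u n t)" for n
  have d: "d n \<in> L2 tf" for n unfolding d_def using u by auto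
  have d_le: "L2_norm tf (d n) \<le> 2 / sqrt \<epsilon> * (1/2) ^ n" for n
  proof (rule power2_le_imp_le)
    have quarter: "((1/2::real) ^ n)\<^sup>2 = (1/4) ^ n"
      by (simp add: power2_eq_square flip: power_mult_distrib)
    \<comment> \<open>The midpoint of two consecutive members cannot go below the infimum;
      eliminating \<open>b\<close> between the two expansions is the parallelogram identity.\<close>
    have "m \<le> J (\<lambda>t. u n t + (1/2) *\<^sub>R d n t)" using u d by (intro m_le) auto
    also have "\<dots> = J (u n) + b (u n) (d n) + q (d n) / 4"
      using expand[OF u d, of n "1/2" n] by (simp add: power2_eq_square)
    finally have "m \<le> J (u n) + b (u n) (d n) + q (d n) / 4" .
    moreover have "J (u (Suc n)) = J (u n) + 2 * b (u n) (d n) + q (d n)"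
      using expand[OF u d, of n 1 n] by (simp add: d_def)
    ultimately have "q (d n) \<le> 2 * (J (u n) + J (u (Suc n)) - 2 * m)" by simp
    moreover have "0 \<le> (1/4::real) ^ n" by simp
    \<comment> \<open>The two excesses give \<open>5/2 * (1/4) ^ n\<close>; it is rounded up to 4 to
      have a perfect square.\<close>
    ultimately have "q (d n) \<le> 4 * (1/4) ^ n"
      using u_less[of n] u_less[of "Suc n", unfolded power_Suc] by argo
    then have "\<epsilon> * (L2_norm tf (d n))\<^sup>2 \<le> 4 * (1/4) ^ n"
      using coer[OF d, of n] by (simp add: q_def)
    then have "(L2_norm tf (d n))\<^sup>2 \<le> 4 * (1/4) ^ n / \<epsilon>"
      using \<epsilon> by (simp add: pos_le_divide_eq mult.commute)
    also have "\<dots> = (2 / sqrt \<epsilon> * (1/2) ^ n)\<^sup>2"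
      using \<epsilon> quarter by (simp add: power_mult_distrib power_divide)
    finally show "(L2_norm tf (d n))\<^sup>2 \<le> (2 / sqrt \<epsilon> * (1/2) ^ n)\<^sup>2" .
  qed (use \<epsilon> in simp)
  have "summable (\<lambda>n. L2_norm tf (d n))"
  proof (rule summable_comparison_test_ev)
    show "summable (\<lambda>n. 2 / sqrt \<epsilon> * (1/2) ^ n)" by (intro summable_mult summable_geometric) simp
    show "\<forall>\<^sub>F n in sequentially. norm (L2_norm tf (d n)) \<le> 2 / sqrt \<epsilon> * (1/2) ^ n"
      using d_le by (intro always_eventually) simp
  qed
  then obtain v where v: "v \<in> L2 tf" and lim: "(\<lambda>n. L2_norm tf (\<lambda>t. u n t - v t)) \<longlonglongrightarrow> 0"
    using L2_complete[of u tf, OF u] unfolding d_def by blast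
  define c where "c = L2_norm tf (S v) + K"
  have b_le: "\<bar>b v w\<bar> \<le> c * L2_norm tf w" if w: "w \<in> L2 tf" for w
    using L2_Cauchy_Schwarz[OF w closed[OF v]] bound[OF w]
      abs_Re_le_cmod[of "L2_inner tf w (S v)"] abs_Re_le_cmod[of "\<phi> w"]
    by (simp add: b_def c_def algebra_simps abs_le_iff)
  have "J v \<le> m"
  proof (rule LIMSEQ_le_const)
    have "(\<lambda>n. m + (1/4) ^ n + 2 * c * L2_norm tf (\<lambda>t. u n t - v t)) \<longlonglongrightarrow> m + 0 + 2 * c * 0"
      by (intro tendsto_add tendsto_const tendsto_mult LIMSEQ_realpow_zero lim) simp_all
    then show "(\<lambda>n. m + (1/4) ^ n + 2 * c * L2_norm tf (\<lambda>t. u n t - v t)) \<longlonglongrightarrow> m"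
      by simp
    have "J v \<le> m + (1/4) ^ n + 2 * c * L2_norm tf (\<lambda>t. u n t - v t)" for n
    proof -
      have w: "(\<lambda>t. u n t - v t) \<in> L2 tf" using u v by auto
      have "J (u n) = J v + 2 * b v (\<lambda>t. u n t - v t) + q (\<lambda>t. u n t - v t)"
        using expand[OF v w, of 1] by simp
      then show ?thesis using u_less[of n] b_le[OF w] q_nonneg[OF w] by (simp add: abs_le_iff)
    qed
    then show "\<exists>N. \<forall>n\<ge>N. J v \<le> m + (1/4) ^ n + 2 * c * L2_norm tf (\<lambda>t. u n t - v t)" by blast
  qed
  have real: "Re (\<phi> w) = Re (L2_inner tf (S v) w)" if w: "w \<in> L2 tf" for w
  proof -
    \<comment> \<open>Since \<open>v\<close> attains the infimum, the increase of \<open>J\<close>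
      is nonnegative in every direction, and the discriminant criterion gives
      \<open>b v w = 0\<close>.\<close>
    have "0 \<le> 0 + 2 * s * b v w + s\<^sup>2 * q w" for s
    proof -
      have "m \<le> J (\<lambda>t. v t + s *\<^sub>R w t)" using v w by (intro m_le) auto
      then show ?thesis using expand[OF v w, of s] \<open>J v \<le> m\<close> by simp
    qed
    then have "(b v w)\<^sup>2 \<le> 0 * q w" using q_nonneg[OF w] by (rule quadratic_nonneg_imp)
    then show ?thesis using Re_L2_inner_commute[of tf "S v" w] by (simp add: b_def)
  qed
  show ?thesis
  proof
    fix w :: "real \<Rightarrow> 'a" assume w: "w \<in> L2 tf"
    \<comment> \<open>Multiplying \<open>w\<close> by \<open>- \<i>\<close> turns imaginary parts
      into real parts.\<close>
    show "\<phi> w = L2_inner tf (S v) w"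
      using real[OF w] real[OF L2_scaleC[OF w, of "- \<i>"]] w
      by (simp add: complex_eq_iff scale L2_inner_scaleC_right)
  qed (rule v)
qed

text \<open>The identity is self-adjoint and coercive with constant 1.\<close>

lemma L2_Riesz:
  assumes "\<And>u v. u \<in> L2 tf \<Longrightarrow> v \<in> L2 tf \<Longrightarrow> \<phi> (\<lambda>t. u t + v t) = \<phi> u + \<phi> v"
    and "\<And>c u. u \<in> L2 tf \<Longrightarrow> \<phi> (\<lambda>t. c *\<^sub>C u t) = c * \<phi> u"
    and "\<And>u. u \<in> L2 tf \<Longrightarrow> cmod (\<phi> u) \<le> K * L2_norm tf u"
  obtains z where "z \<in> L2 tf" "\<And>v. v \<in> L2 tf \<Longrightarrow> \<phi> v = L2_inner tf z v"
proof -
  have "L2_selfadjoint tf (\<lambda>u. u)" by (simp add: L2_selfadjoint_def L2_bounded_operator_id)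
  moreover have "L2_coercive tf (\<lambda>u. u)"
    unfolding L2_coercive_def by (intro exI[of _ 1]) (simp add: L2_inner_self)
  ultimately show ?thesis
    by (rule L2_Lax_Milgram_selfadjoint[where \<phi> = \<phi> and K = K]) (fact assms that)+
qed

section \<open>Adjoints, and inverses of coercive operators\<close>

text \<open>Justifies the choice in the definition. For each \<open>y\<close>, Riesz represents the
  functional sending \<open>u\<close> to \<open>L2_inner tf y (S u)\<close>; selecting a
  representing function for each \<open>y\<close> gives a candidate \<open>T\<close>, and its
  linearity up to null sets comes from the adjoint relation.\<close>

lemma L2_adjoint:
  fixes S :: "(real \<Rightarrow> 'a::chilbert_space) \<Rightarrow> real \<Rightarrow> 'b::chilbert_space"
  assumes S: "L2_bounded_operator tf S"
  shows "L2_bounded_operator tf (L2_adjoint tf S)"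
    and "\<And>u y. u \<in> L2 tf \<Longrightarrow> y \<in> L2 tf \<Longrightarrow>
      L2_inner tf (S u) y = L2_inner tf u (L2_adjoint tf S y)"
proof -
  note closed = L2_bounded_operator_closed[OF S]
  obtain K where K: "K \<ge> 0" "\<And>u. u \<in> L2 tf \<Longrightarrow> L2_norm tf (S u) \<le> K * L2_norm tf u"
    using L2_bounded_operator_bound[OF S] by metis
  have "\<exists>z\<in>L2 tf. \<forall>u\<in>L2 tf. L2_inner tf y (S u) = L2_inner tf z u" if y: "y \<in> L2 tf" for y
  proof -
    obtain z where "z \<in> L2 tf" "\<And>u. u \<in> L2 tf \<Longrightarrow> L2_inner tf y (S u) = L2_inner tf z u"
    proof (rule L2_Riesz)
      fix u v :: "real \<Rightarrow> 'a" assume uv: "u \<in> L2 tf" "v \<in> L2 tf"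
      have "L2_inner tf y (S (\<lambda>t. u t + v t)) = L2_inner tf y (\<lambda>t. S u t + S v t)"
        using uv closed y by (intro L2_inner_cong_right L2_bounded_operator_add[OF S]) auto
      then show "L2_inner tf y (S (\<lambda>t. u t + v t)) = L2_inner tf y (S u) + L2_inner tf y (S v)"
        using uv closed y by (simp add: L2_inner_add_right)
    next
      fix c and u :: "real \<Rightarrow> 'a" assume u: "u \<in> L2 tf"
      have "L2_inner tf y (S (\<lambda>t. c *\<^sub>C u t)) = L2_inner tf y (\<lambda>t. c *\<^sub>C S u t)"
        using u closed y by (intro L2_inner_cong_right L2_bounded_operator_scaleC[OF S]) auto
      then show "L2_inner tf y (S (\<lambda>t. c *\<^sub>C u t)) = c * L2_inner tf y (S u)"
        by (simp add: L2_inner_scaleC_right)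
    next
      fix u :: "real \<Rightarrow> 'a" assume u: "u \<in> L2 tf"
      show "cmod (L2_inner tf y (S u)) \<le> (L2_norm tf y * K) * L2_norm tf u"
        using L2_Cauchy_Schwarz[OF y closed[OF u]] mult_left_mono[OF K(2)[OF u], of "L2_norm tf y"]
        by (simp add: mult.assoc)
    qed blast
    then show ?thesis by blast
  qed
  then obtain T where T: "\<And>y. y \<in> L2 tf \<Longrightarrow> T y \<in> L2 tf"
    and T_inner: "\<And>y u. y \<in> L2 tf \<Longrightarrow> u \<in> L2 tf \<Longrightarrow> L2_inner tf y (S u) = L2_inner tf (T y) u"
    by metis
  have adj: "L2_inner tf (S u) y = L2_inner tf u (T y)" if "y \<in> L2 tf" "u \<in> L2 tf" for u y
    using T_inner[OF that] by (metis L2_inner_commute)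
  have "L2_norm tf (T y) \<le> K * L2_norm tf y" if y: "y \<in> L2 tf" for y
  proof (cases "L2_norm tf (T y) = 0")
    case True
    then show ?thesis using K(1) by simp
  next
    case False
    \<comment> \<open>Testing the relation with \<open>T y\<close> itself produces a factor
      \<open>L2_norm tf (T y)\<close> on both sides, which cancels as it is nonzero.\<close>
    have "(L2_norm tf (T y))\<^sup>2 = cmod (L2_inner tf (T y) (T y))"
      by (simp add: L2_inner_self del: of_real_power)
    also have "\<dots> = cmod (L2_inner tf y (S (T y)))" using T_inner y T by simp
    also have "\<dots> \<le> L2_norm tf y * L2_norm tf (S (T y))"
      using y T closed by (intro L2_Cauchy_Schwarz) auto
    also have "\<dots> \<le> L2_norm tf y * (K * L2_norm tf (T y))"
      using y T K(2) by (intro mult_left_mono) auto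
    finally have "L2_norm tf (T y) * L2_norm tf (T y) \<le> (K * L2_norm tf y) * L2_norm tf (T y)"
      by (simp add: power2_eq_square algebra_simps)
    then show ?thesis using False L2_norm_nonneg[of tf "T y"] by (auto dest: mult_right_le_imp_le)
  qed
  then have "L2_bounded_operator tf T"
    using closed T adj by (intro L2_bounded_operatorI_adjoint[of tf S T K]) auto
  then have ex: "\<exists>T. L2_bounded_operator tf T \<and>
      (\<forall>u\<in>L2 tf. \<forall>y\<in>L2 tf. L2_inner tf (S u) y = L2_inner tf u (T y))"
    using adj by blast
  show "L2_bounded_operator tf (L2_adjoint tf S)"
    and "\<And>u y. u \<in> L2 tf \<Longrightarrow> y \<in> L2 tf \<Longrightarrow>
      L2_inner tf (S u) y = L2_inner tf u (L2_adjoint tf S y)"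
    using someI_ex[OF ex] unfolding L2_adjoint_def by auto
qed

lemma L2_is_inverse_L2_inverse:
  "L2_is_inverse tf S S' \<Longrightarrow> L2_is_inverse tf S (L2_inverse tf S)"
  unfolding L2_inverse_def by (rule someI[where P = "L2_is_inverse tf S"])

text \<open>Minimisation solves \<open>S u = f\<close>, so a right inverse \<open>T\<close> can be
  selected. Coercivity with Cauchy-Schwarz bounds \<open>S\<close> from below; hence
  \<open>T\<close> is also a left inverse, with bound \<open>1 / \<epsilon>\<close>.\<close>

lemma L2_coercive_imp_is_inverse:
  fixes S :: "(real \<Rightarrow> 'a::chilbert_space) \<Rightarrow> real \<Rightarrow> 'a"
  assumes S: "L2_selfadjoint tf S" and coercive: "L2_coercive tf S"
  shows "L2_is_inverse tf S (L2_inverse tf S)"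
proof -
  note B = L2_selfadjoint_bounded[OF S]
  note closed = L2_bounded_operator_closed[OF B]
  obtain \<epsilon> where \<epsilon>: "\<epsilon> > 0"
    and coer: "\<And>u. u \<in> L2 tf \<Longrightarrow> \<epsilon> * (L2_norm tf u)\<^sup>2 \<le> Re (L2_inner tf u (S u))"
    using coercive unfolding L2_coercive_def by blast
  have lower: "\<epsilon> * L2_norm tf u \<le> L2_norm tf (S u)" if u: "u \<in> L2 tf" for u
  proof (cases "L2_norm tf u = 0")
    case False
    have "\<epsilon> * (L2_norm tf u)\<^sup>2 \<le> L2_norm tf u * L2_norm tf (S u)"
      using coer[OF u] L2_Cauchy_Schwarz[OF u closed[OF u]]
        complex_Re_le_cmod[of "L2_inner tf u (S u)"] by simp
    then have "(\<epsilon> * L2_norm tf u) * L2_norm tf u \<le> L2_norm tf (S u) * L2_norm tf u"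
      by (simp add: power2_eq_square mult_ac)
    then show ?thesis using False L2_norm_nonneg[of tf u] by (auto dest: mult_right_le_imp_le)
  qed simp
  have "\<exists>u\<in>L2 tf. L2_eq tf (S u) f" if f: "f \<in> L2 tf" for f
  proof -
    obtain u where u: "u \<in> L2 tf" "\<And>v. v \<in> L2 tf \<Longrightarrow> L2_inner tf f v = L2_inner tf (S u) v"
      by (rule L2_Lax_Milgram_selfadjoint[OF S coercive, of "L2_inner tf f" "L2_norm tf f"])
        (auto simp: f L2_inner_add_right L2_inner_scaleC_right L2_Cauchy_Schwarz)
    have "L2_eq tf (S u) f"
      using u(2) by (intro L2_eqI closed u f) (metis L2_inner_commute)
    then show ?thesis using u(1) by blast
  qed
  then obtain T where T: "\<And>f. f \<in> L2 tf \<Longrightarrow> T f \<in> L2 tf"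
    and ST: "\<And>f. f \<in> L2 tf \<Longrightarrow> L2_eq tf (S (T f)) f"
    by metis
  have S_norm: "L2_norm tf (\<lambda>t. S u t - S v t) = L2_norm tf (S (\<lambda>t. u t - v t))"
    if "u \<in> L2 tf" "v \<in> L2 tf" for u v
  proof -
    let ?f = "S (\<lambda>t. u t - v t)" and ?g = "\<lambda>t. S u t - S v t"
    have mem: "?f \<in> L2 tf" "?g \<in> L2 tf" using that closed by auto
    have eq: "L2_eq tf ?f ?g" using B that by (rule L2_bounded_operator_diff)
    have "L2_inner tf ?f ?f = L2_inner tf ?g ?f" using eq mem by (intro L2_inner_cong_left) auto
    also have "\<dots> = L2_inner tf ?g ?g" using eq mem by (intro L2_inner_cong_right) auto
    finally have "(L2_norm tf ?f)\<^sup>2 = (L2_norm tf ?g)\<^sup>2" unfolding L2_inner_self of_real_eq_iff .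
    then show ?thesis by (simp add: power2_eq_iff_nonneg)
  qed
  have TS: "L2_eq tf (T (S u)) u" if u: "u \<in> L2 tf" for u
  proof -
    have mem: "T (S u) \<in> L2 tf" using T closed u by auto
    have "L2_norm tf (\<lambda>t. S (T (S u)) t - S u t) = 0"
      using ST[OF closed[OF u]] closed mem u by (simp add: L2_eq_iff_norm_diff)
    then have "\<epsilon> * L2_norm tf (\<lambda>t. T (S u) t - u t) \<le> 0"
      using lower[of "\<lambda>t. T (S u) t - u t"] mem u by (simp add: S_norm)
    then show ?thesis
      using \<epsilon> mem u L2_norm_nonneg[of tf "\<lambda>t. T (S u) t - u t"]
      by (simp add: L2_eq_iff_norm_diff mult_le_0_iff)
  qed
  have "L2_bounded_operator tf T"
  proof (rule L2_bounded_operatorI_adjoint)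
    fix u v :: "real \<Rightarrow> 'a" assume uv: "u \<in> L2 tf" "v \<in> L2 tf"
    have mem: "T u \<in> L2 tf" "T v \<in> L2 tf" "S (T u) \<in> L2 tf" "S (T v) \<in> L2 tf"
      using uv T closed by auto
    \<comment> \<open>The inverse inherits symmetry from \<open>S\<close>, and symmetry gives
      linearity of the selected \<open>T\<close>.\<close>
    have "L2_inner tf (T v) u = L2_inner tf (T v) (S (T u))"
      using L2_eq_sym[OF ST[OF uv(1)]] uv mem by (intro L2_inner_cong_right) auto
    also have "\<dots> = L2_inner tf (S (T v)) (T u)" using L2_selfadjoint_inner[OF S] mem by simp
    also have "\<dots> = L2_inner tf v (T u)" using ST[OF uv(2)] uv mem by (intro L2_inner_cong_left) auto
    finally show "L2_inner tf (T v) u = L2_inner tf v (T u)" .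
  next
    fix f :: "real \<Rightarrow> 'a" assume f: "f \<in> L2 tf"
    have mem: "T f \<in> L2 tf" "S (T f) \<in> L2 tf" using f T closed by auto
    have "L2_norm tf (\<lambda>t. (S (T f) t - f t) + f t) \<le> L2_norm tf (\<lambda>t. S (T f) t - f t) + L2_norm tf f"
      using mem f by (intro L2_norm_triangle) auto
    then have "L2_norm tf (S (T f)) \<le> L2_norm tf f"
      using ST[OF f] f mem by (simp add: L2_eq_iff_norm_diff)
    then have "\<epsilon> * L2_norm tf (T f) \<le> L2_norm tf f" using lower[OF mem(1)] by simp
    then show "L2_norm tf (T f) \<le> (1 / \<epsilon>) * L2_norm tf f"
      using \<epsilon> by (simp add: field_simps)
  qed (use T in auto)
  then have "L2_is_inverse tf S T" using ST TS by (simp add: L2_is_inverse_def)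
  then show ?thesis by (rule L2_is_inverse_L2_inverse)
qed

section \<open>The optimal control problem\<close>

lemma L2_selfadjoint_mult_op:
  fixes Q :: "real \<Rightarrow> 'a::chilbert_space \<Rightarrow>\<^sub>L 'a"
  assumes Q: "Q \<in> Linf_op tf" and sa: "pointwise_selfadjoint tf Q"
  shows "L2_selfadjoint tf (mult_op Q)"
proof -
  let ?M = "lebesgue_on {0..tf}"
  have Q_meas: "strongly_measurable ?M Q"
    and Q_lin: "AE t in ?M. bounded_clinear (blinfun_apply (Q t))"
    using Q by (auto simp: Linf_op_def)
  obtain K where K: "AE t in ?M. norm (Q t) \<le> K"
    using Q by (auto simp: Linf_op_def)
  define L where "L = max K 0"
  have le: "AE t in ?M. (norm (mult_op Q u t))\<^sup>2 \<le> L\<^sup>2 * (norm (u t))\<^sup>2" for u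
    using K
  proof eventually_elim
    case (elim t)
    have "norm (Q t (u t)) \<le> norm (Q t) * norm (u t)" by (rule norm_blinfun)
    also have "\<dots> \<le> L * norm (u t)" using elim by (intro mult_right_mono) (auto simp: L_def)
    finally have "(norm (Q t (u t)))\<^sup>2 \<le> (L * norm (u t))\<^sup>2" by (intro power_mono) auto
    then show ?case by (simp add: mult_op_def power_mult_distrib)
  qed
  have int: "integrable ?M (\<lambda>t. L\<^sup>2 * (norm (u t))\<^sup>2)" if "u \<in> L2 tf" for u :: "real \<Rightarrow> 'a"
    using L2_integrable_norm_square[OF that] by simp
  have mem: "mult_op Q u \<in> L2 tf" if u: "u \<in> L2 tf" for u
  proof (rule L2I_bound[OF _ int[OF u] le])
    show "strongly_measurable ?M (mult_op Q u)"
      unfolding mult_op_def using Q_meas L2_strongly_measurable[OF u]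
      by (intro strongly_measurable_compose2[where h = blinfun_apply] blinfun.tendsto)
  qed
  have "L2_norm tf (mult_op Q u) \<le> L * L2_norm tf u" if u: "u \<in> L2 tf" for u
  proof (rule power2_le_imp_le)
    have "(L2_norm tf (mult_op Q u))\<^sup>2 \<le> integral\<^sup>L ?M (\<lambda>t. L\<^sup>2 * (norm (u t))\<^sup>2)"
      unfolding L2_norm_square
      using L2_integrable_norm_square[OF mem[OF u]] int[OF u] le by (rule integral_mono_AE)
    then show "(L2_norm tf (mult_op Q u))\<^sup>2 \<le> (L * L2_norm tf u)\<^sup>2"
      by (simp add: power_mult_distrib L2_norm_square)
  qed (simp add: L_def)
  moreover have "L2_eq tf (mult_op Q (\<lambda>t. u t + v t)) (\<lambda>t. mult_op Q u t + mult_op Q v t)" for u v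
    by (simp add: mult_op_def blinfun.add_right)
  \<comment> \<open>The type of \<open>Q t\<close> provides real linearity only; complex homogeneity
    comes from the a.e. clause of \<open>Linf_op\<close>.\<close>
  moreover have "L2_eq tf (mult_op Q (\<lambda>t. c *\<^sub>C u t)) (\<lambda>t. c *\<^sub>C mult_op Q u t)" for c u
    unfolding L2_eq_def using Q_lin
    by eventually_elim (simp add: mult_op_def bounded_clinear_on_def clinear_on_def)
  ultimately have "L2_bounded_operator tf (mult_op Q)"
    unfolding L2_bounded_operator_def using mem by auto
  moreover have "L2_inner tf (mult_op Q u) v = L2_inner tf u (mult_op Q v)"
    if uv: "u \<in> L2 tf" "v \<in> L2 tf" for u v
    unfolding L2_inner_def
  proof (rule integral_cong_AE)
    show "AE t in ?M. cinner (mult_op Q u t) (v t) = cinner (u t) (mult_op Q v t)"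
      using sa unfolding pointwise_selfadjoint_def by eventually_elim (simp add: mult_op_def)
  qed (use uv mem in \<open>auto intro!: borel_measurable_integrable L2_integrable_cinner\<close>)
  ultimately show ?thesis by (simp add: L2_selfadjoint_def)
qed

section \<open>Semigroup orbits and square integrability of the output\<close>

lemma bounded_clinear_imp_bounded_linear:
  assumes "bounded_clinear f"
  shows "bounded_linear f"
proof -
  obtain K where K: "\<And>x. norm (f x) \<le> K * norm x"
    using assms by (auto simp: bounded_clinear_on_def)
  show ?thesis
    by (rule bounded_linear_intro[where K = K])
      (use assms K in \<open>simp_all add: bounded_clinear_on_def clinear_on_def scaleR_scaleC mult.commute\<close>)
qed

text \<open>The semigroup law and the uniform bound reduce the distance of two orbit points to that
  of \<open>S h x\<close> from \<open>x\<close>, where \<open>h \<ge> 0\<close> is the time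
  difference. Right continuity at 0 thus gives continuity from both sides.\<close>

lemma C0_semigroup_orbit_continuous:
  assumes S: "C0_semigroup_on V S" and x: "x \<in> V"
    and bound: "\<And>t y. t \<ge> 0 \<Longrightarrow> y \<in> V \<Longrightarrow> norm (S t y) \<le> M * norm y"
  shows "continuous_on {0..} (\<lambda>t. S t x)"
proof -
  have V: "csubspace V" and S_V: "\<And>t y. t \<ge> 0 \<Longrightarrow> y \<in> V \<Longrightarrow> S t y \<in> V"
    and lin: "\<And>t. t \<ge> 0 \<Longrightarrow> clinear_on V (S t)"
    and zero: "S 0 x = x" and add: "\<And>s t. s \<ge> 0 \<Longrightarrow> t \<ge> 0 \<Longrightarrow> S (s + t) x = S s (S t x)"
    and right: "((\<lambda>t. S t x) \<longlongrightarrow> x) (at_right 0)"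
    using S x by (auto simp: C0_semigroup_on_def bounded_clinear_on_def)
  have add_V: "y + z \<in> V" "c *\<^sub>C z \<in> V" if "y \<in> V" "z \<in> V" for y z c
    using V that by (auto simp: csubspace_def)
  have diff: "S t (y - z) = S t y - S t z" "y - z \<in> V" if "t \<ge> 0" "y \<in> V" "z \<in> V" for t y z
  proof -
    \<comment> \<open>Subspaces and linearity are given by sums and complex multiples, so
      differences go through the scalar -1.\<close>
    have "S t (y + (-1) *\<^sub>C z) = S t y + S t ((-1) *\<^sub>C z)"
      using lin[OF that(1)] that add_V unfolding clinear_on_def by blast
    also have "S t ((-1) *\<^sub>C z) = (-1) *\<^sub>C S t z"
      using lin[OF that(1)] that unfolding clinear_on_def by blast
    finally show "S t (y - z) = S t y - S t z" by simp
    show "y - z \<in> V" using add_V(1)[OF that(2) add_V(2)[OF that(2,3), of "-1"]] by simp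
  qed
  \<comment> \<open>A positive constant is needed for the tolerance
    \<open>e / max M 1\<close>.\<close>
  have M: "max M 1 > 0" by simp
  have le: "dist (S t x) (S s x) \<le> max M 1 * dist (S (t - s) x) x" if "0 \<le> s" "s \<le> t" for s t
  proof -
    have "S t x - S s x = S s (S (t - s) x - x)" "S (t - s) x - x \<in> V"
      using that diff[of s "S (t - s) x" x] S_V x add[of s "t - s"] by auto
    then have "norm (S t x - S s x) \<le> M * norm (S (t - s) x - x)" using bound that by auto
    also have "\<dots> \<le> max M 1 * norm (S (t - s) x - x)" by (intro mult_right_mono) auto
    finally show ?thesis by (simp add: dist_norm)
  qed
  show ?thesis
    unfolding continuous_on_iff
  proof (intro ballI allI impI)
    fix s e :: real assume s: "s \<in> {0..}" and e: "e > 0"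
    have "eventually (\<lambda>h. dist (S h x) x < e / max M 1) (at_right 0)"
      using right e M by (intro tendstoD) (simp_all add: divide_pos_pos)
    then obtain b where b: "b > 0" "\<And>h. 0 < h \<Longrightarrow> h < b \<Longrightarrow> dist (S h x) x < e / max M 1"
      unfolding eventually_at_right_field by auto
    have small: "max M 1 * dist (S h x) x < e" if "0 \<le> h" "h < b" for h
    proof (cases "h = 0")
      case True
      then show ?thesis using zero e by simp
    next
      case False
      then show ?thesis using b(2)[of h] that M by (simp add: pos_less_divide_eq mult.commute)
    qed
    have "dist (S t x) (S s x) < e" if "t \<in> {0..}" "dist t s < b" for t
    proof (cases "s \<le> t")
      case True
      then show ?thesis using le[of s t] small[of "t - s"] s that by (simp add: dist_real_def)
    next
      case False
      then show ?thesis using le[of t s] small[of "s - t"] s that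
        by (simp add: dist_real_def dist_commute)
    qed
    then show "\<exists>d>0. \<forall>t\<in>{0..}. dist t s < d \<longrightarrow> dist (S t x) (S s x) < e" using b(1) by blast
  qed
qed

lemma continuous_on_imp_L2:
  assumes f: "continuous_on {0..tf} f"
  shows "f \<in> L2 tf"
proof -
  have "continuous_on {0..tf} (\<lambda>t. (norm (f t))\<^sup>2)" using f by (intro continuous_intros)
  then have "integrable (lebesgue_on {0..tf}) (\<lambda>t. (norm (f t))\<^sup>2)"
    by (rule continuous_imp_integrable_real)
  then show ?thesis
    unfolding L2_def using continuous_on_imp_strongly_measurable[OF f] by simp
qed

text \<open>Stability bounds \<open>S t (P x)\<close>. Since \<open>P\<close> fixes \<open>V\<close>
  pointwise and the exponential is at most 1, it bounds \<open>S t\<close> on \<open>V\<close>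
  uniformly in \<open>t\<close>, as continuity of orbits requires.\<close>

lemma output_map_in_L2:
  assumes C: "bounded_clinear C" and P: "is_projection P V W" and S: "C0_semigroup_on V S"
    and stable: "exponentially_stable (\<lambda>t x. S t (P x))"
  shows "output_map (\<lambda>t x. S t (P x)) C x0 \<in> L2 tf"
proof -
  obtain M \<delta> where "M > 0" "\<delta> > 0"
    and M: "\<And>t x. t \<ge> 0 \<Longrightarrow> norm (S t (P x)) \<le> M * exp (- \<delta> * t) * norm x"
    using stable unfolding exponentially_stable_def by blast
  have PV: "range P = V" and PP: "\<And>x. P (P x) = P x" using P by (auto simp: is_projection_def)
  have "norm (S t y) \<le> M * norm y" if t: "t \<ge> 0" and y: "y \<in> V" for t y
  proof -
    have "P y = y" using PV PP y by auto
    then have "norm (S t y) \<le> M * exp (- \<delta> * t) * norm y" using M[OF t, of y] by simp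
    also have "\<dots> \<le> M * 1 * norm y"
      using \<open>M > 0\<close> \<open>\<delta> > 0\<close> t by (intro mult_right_mono mult_left_mono) auto
    finally show ?thesis by simp
  qed
  then have "continuous_on {0..} (\<lambda>t. S t (P x0))"
    using PV by (intro C0_semigroup_orbit_continuous[OF S]) auto
  then have "continuous_on {0..tf} (\<lambda>t. C (S t (P x0)))"
    by (intro bounded_linear.continuous_on[OF bounded_clinear_imp_bounded_linear[OF C]])
      (auto intro: continuous_on_subset)
  then show ?thesis unfolding output_map_def by (rule continuous_on_imp_L2)
qed

section \<open>The first variation of the cost\<close>

lemma L2_selfadjoint_conjugate:
  assumes F: "L2_bounded_operator tf F" and S: "L2_selfadjoint tf S"
  shows "L2_selfadjoint tf (\<lambda>u. L2_adjoint tf F (S (F u)))"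
proof -
  have "L2_inner tf (L2_adjoint tf F (S (F u))) v = L2_inner tf u (L2_adjoint tf F (S (F v)))"
    if uv: "u \<in> L2 tf" "v \<in> L2 tf" for u v
  proof -
    note closed = L2_bounded_operator_closed[OF F] L2_bounded_operator_closed[OF L2_selfadjoint_bounded[OF S]]
    have "L2_inner tf (L2_adjoint tf F (S (F u))) v = cnj (L2_inner tf (F v) (S (F u)))"
      using uv closed by (subst L2_inner_commute) (simp add: L2_adjoint(2)[OF F])
    also have "\<dots> = L2_inner tf (S (F u)) (F v)" by (rule L2_inner_commute[symmetric])
    also have "\<dots> = L2_inner tf (F u) (S (F v))" using uv closed by (intro L2_selfadjoint_inner[OF S]) auto
    also have "\<dots> = L2_inner tf u (L2_adjoint tf F (S (F v)))"
      using uv closed by (intro L2_adjoint(2)[OF F]) auto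
    finally show ?thesis .
  qed
  then show ?thesis
    unfolding L2_selfadjoint_def
    using L2_bounded_operator_compose[OF L2_adjoint(1)[OF F]
        L2_bounded_operator_compose[OF L2_selfadjoint_bounded[OF S] F]] by blast
qed

lemma L2_selfadjoint_sum:
  assumes S: "L2_selfadjoint tf S" and T: "L2_selfadjoint tf T"
  shows "L2_selfadjoint tf (\<lambda>u t. S u t + T u t)"
  unfolding L2_selfadjoint_def
proof (intro conjI ballI)
  show "L2_bounded_operator tf (\<lambda>u t. S u t + T u t)"
    using S T by (intro L2_bounded_operator_sum L2_selfadjoint_bounded)
  note closed = L2_bounded_operator_closed[OF L2_selfadjoint_bounded[OF S]]
    L2_bounded_operator_closed[OF L2_selfadjoint_bounded[OF T]]
  show "L2_inner tf (\<lambda>t. S u t + T u t) v = L2_inner tf u (\<lambda>t. S v t + T v t)"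
    if "u \<in> L2 tf" "v \<in> L2 tf" for u v
    using that closed
    by (simp add: L2_inner_add_left L2_inner_add_right L2_selfadjoint_inner[OF S] L2_selfadjoint_inner[OF T])
qed

text \<open>The control is varied along the gradient \<open>?g\<close> itself. The increase of the
  functional at \<open>u + s ?g\<close> is then \<open>2 * s * b + s\<^sup>2 * c\<close>, where
  \<open>b\<close> is the squared norm of \<open>?g\<close>; nonnegativity for all \<open>s\<close>
  forces \<open>b = 0\<close>.\<close>

lemma L2_minimizer_stationary:
  fixes F :: "(real \<Rightarrow> 'u::chilbert_space) \<Rightarrow> real \<Rightarrow> 'y::chilbert_space"
  assumes S: "L2_selfadjoint tf S" and T: "L2_selfadjoint tf T" and F: "L2_bounded_operator tf F"
    and \<psi>: "\<psi> \<in> L2 tf" and u: "u \<in> L2 tf"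
    and nonneg: "\<And>v. v \<in> L2 tf \<Longrightarrow> 0 \<le> Re (L2_inner tf (F v) (S (F v))) + Re (L2_inner tf v (T v))"
    and min: "\<And>v. v \<in> L2 tf \<Longrightarrow>
      Re (L2_inner tf (\<lambda>t. \<psi> t + F u t) (S (\<lambda>t. \<psi> t + F u t))) + Re (L2_inner tf u (T u)) \<le>
      Re (L2_inner tf (\<lambda>t. \<psi> t + F v t) (S (\<lambda>t. \<psi> t + F v t))) + Re (L2_inner tf v (T v))"
  shows "L2_eq tf (\<lambda>t. T u t + L2_adjoint tf F (S (\<lambda>t. \<psi> t + F u t)) t) (\<lambda>t. 0)"
proof -
  let ?y = "\<lambda>t. \<psi> t + F u t"
  let ?g = "\<lambda>t. T u t + L2_adjoint tf F (S ?y) t"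
  note closed = L2_bounded_operator_closed[OF F] L2_bounded_operator_closed[OF L2_adjoint(1)[OF F]]
    L2_bounded_operator_closed[OF L2_selfadjoint_bounded[OF S]]
    L2_bounded_operator_closed[OF L2_selfadjoint_bounded[OF T]]
  have y: "?y \<in> L2 tf" using \<psi> u closed by auto
  have g: "?g \<in> L2 tf" using y u closed by auto
  let ?w = "\<lambda>s t. u t + s *\<^sub>R ?g t"
  define b where "b = Re (L2_inner tf ?g ?g)"
  define c where "c = Re (L2_inner tf (F ?g) (S (F ?g))) + Re (L2_inner tf ?g (T ?g))"
  have "0 \<le> 0 + 2 * s * b + s\<^sup>2 * c" for s
  proof -
    have w: "?w s \<in> L2 tf" using u g by auto
    have Fw: "L2_eq tf (F (?w s)) (\<lambda>t. F u t + s *\<^sub>R F ?g t)"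
      by (rule L2_eq_trans[OF L2_bounded_operator_add[OF F u L2_scaleR[OF g]]
          L2_eq_add[OF L2_eq_refl L2_bounded_operator_scaleR[OF F g]]])
    then have "L2_eq tf (\<lambda>t. \<psi> t + F (?w s) t) (\<lambda>t. ?y t + s *\<^sub>R F ?g t)"
      using L2_eq_add[OF L2_eq_refl[of tf \<psi>] Fw] by (simp add: add.assoc)
    then have "Re (L2_inner tf (\<lambda>t. \<psi> t + F (?w s) t) (S (\<lambda>t. \<psi> t + F (?w s) t))) =
        Re (L2_inner tf ?y (S ?y)) + 2 * s * Re (L2_inner tf (F ?g) (S ?y)) +
        s\<^sup>2 * Re (L2_inner tf (F ?g) (S (F ?g)))"
      using \<psi> w g closed by (intro L2_quadratic_form_expand[OF S y]) auto
    moreover have "Re (L2_inner tf (?w s) (T (?w s))) =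
        Re (L2_inner tf u (T u)) + 2 * s * Re (L2_inner tf ?g (T u)) + s\<^sup>2 * Re (L2_inner tf ?g (T ?g))"
      by (rule L2_quadratic_form_expand[OF T u g w]) simp
    \<comment> \<open>The adjoint moves \<open>F\<close> onto \<open>?g\<close>, which identifies
      the two linear coefficients with the squared norm of the gradient.\<close>
    moreover have "b = Re (L2_inner tf ?g (T u)) + Re (L2_inner tf (F ?g) (S ?y))"
      unfolding b_def L2_adjoint(2)[OF F g closed(3)[OF y]]
      using g u y closed by (subst L2_inner_add_right) auto
    ultimately show ?thesis using min[OF w] unfolding c_def by (simp only: distrib_left)
  qed
  then have "b\<^sup>2 \<le> 0 * c" using nonneg[OF g] unfolding c_def by (rule quadratic_nonneg_imp)
  then have "L2_norm tf ?g = 0" by (simp add: b_def L2_inner_self)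
  then show ?thesis using g by (simp add: L2_eq_iff_norm_diff)
qed

lemma L2_coercive_nonneg:
  assumes "L2_coercive tf S" "v \<in> L2 tf"
  shows "0 \<le> Re (L2_inner tf v (S v))"
proof -
  obtain \<epsilon> where "\<epsilon> > 0" "\<forall>u\<in>L2 tf. \<epsilon> * (L2_norm tf u)\<^sup>2 \<le> Re (L2_inner tf u (S u))"
    using assms(1) unfolding L2_coercive_def by auto
  then have "0 \<le> \<epsilon> * (L2_norm tf v)\<^sup>2" "\<epsilon> * (L2_norm tf v)\<^sup>2 \<le> Re (L2_inner tf v (S v))"
    using assms(2) by simp_all
  then show ?thesis by (rule order_trans)
qed

section \<open>Inverting the feedback operator\<close>

lemma L2_is_inverseD:
  assumes "L2_is_inverse tf S S'"
  shows "L2_bounded_operator tf S'" "\<And>u. u \<in> L2 tf \<Longrightarrow> L2_eq tf (S' (S u)) u"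
    "\<And>v. v \<in> L2 tf \<Longrightarrow> L2_eq tf (S (S' v)) v"
  using assms by (auto simp: L2_is_inverse_def)

text \<open>With \<open>N = T + G\<close>, the operator \<open>I - N'G\<close> equals
  \<open>N'(N - G) = N'T\<close> up to null sets, and the inverse of this product is
  \<open>T'N\<close>. It is applied with \<open>T\<close> the multiplication by \<open>R\<close> and
  \<open>G\<close> the conjugated weight.\<close>

lemma L2_inverse_minus_perturbation:
  fixes T G :: "(real \<Rightarrow> 'a::chilbert_space) \<Rightarrow> real \<Rightarrow> 'a"
  assumes T: "L2_bounded_operator tf T" and G: "L2_bounded_operator tf G"
    and T': "L2_is_inverse tf T T'" and N': "L2_is_inverse tf (\<lambda>u t. T u t + G u t) N'"
  shows "L2_bounded_operator tf (\<lambda>u t. u t - N' (G u) t)" (is "L2_bounded_operator tf ?H")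
    and "\<And>u. u \<in> L2 tf \<Longrightarrow> L2_eq tf (\<lambda>t. u t - N' (G u) t) (N' (T u))"
    and "L2_is_inverse tf (\<lambda>u t. u t - N' (G u) t) (\<lambda>u. T' (\<lambda>t. T u t + G u t))"
proof -
  let ?N = "\<lambda>u t. T u t + G u t"
  have N: "L2_bounded_operator tf ?N" using T G by (rule L2_bounded_operator_sum)
  note BT' = L2_is_inverseD(1)[OF T'] and BN' = L2_is_inverseD(1)[OF N']
  note closed = L2_bounded_operator_closed[OF T] L2_bounded_operator_closed[OF G]
    L2_bounded_operator_closed[OF BT'] L2_bounded_operator_closed[OF BN']
  have N_closed: "?N u \<in> L2 tf" if "u \<in> L2 tf" for u using that closed by auto
  show H: "L2_eq tf (?H u) (N' (T u))" if u: "u \<in> L2 tf" for u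
  proof -
    have "L2_eq tf u (N' (?N u))" by (rule L2_eq_sym[OF L2_is_inverseD(2)[OF N' u]])
    also have "L2_eq tf (N' (?N u)) (\<lambda>t. N' (T u) t + N' (G u) t)"
      using u closed by (intro L2_bounded_operator_add[OF BN']) auto
    finally have "L2_eq tf (?H u) (\<lambda>t. (N' (T u) t + N' (G u) t) - N' (G u) t)"
      by (intro L2_eq_diff) auto
    then show ?thesis by simp
  qed
  have H_closed: "?H u \<in> L2 tf" if "u \<in> L2 tf" for u using that closed by auto
  show "L2_bounded_operator tf ?H"
    by (rule L2_bounded_operator_transfer[OF L2_bounded_operator_compose[OF BN' T] H_closed H])
  show "L2_is_inverse tf ?H (\<lambda>u. T' (?N u))"
    unfolding L2_is_inverse_def
  proof (intro conjI ballI)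
    show "L2_bounded_operator tf (\<lambda>u. T' (?N u))"
      by (rule L2_bounded_operator_compose[OF BT' N])
  next
    fix u :: "real \<Rightarrow> 'a" assume u: "u \<in> L2 tf"
    have "L2_eq tf (?N (?H u)) (?N (N' (T u)))"
      using u closed H_closed H by (intro L2_bounded_operator_cong[OF N]) auto
    also have "L2_eq tf (?N (N' (T u))) (T u)" using u closed by (intro L2_is_inverseD(3)[OF N']) auto
    finally have "L2_eq tf (T' (?N (?H u))) (T' (T u))"
      using u closed H_closed N_closed by (intro L2_bounded_operator_cong[OF BT']) auto
    also have "L2_eq tf (T' (T u)) u" using u by (rule L2_is_inverseD(2)[OF T'])
    finally show "L2_eq tf (T' (?N (?H u))) u" .
  next
    fix u :: "real \<Rightarrow> 'a" assume u: "u \<in> L2 tf"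
    have "L2_eq tf (?H (T' (?N u))) (N' (T (T' (?N u))))"
      using u closed N_closed by (intro H) auto
    also have "L2_eq tf (N' (T (T' (?N u)))) (N' (?N u))"
      using u closed N_closed by (intro L2_bounded_operator_cong[OF BN'] L2_is_inverseD(3)[OF T']) auto
    also have "L2_eq tf (N' (?N u)) u" using u by (rule L2_is_inverseD(2)[OF N'])
    finally show "L2_eq tf (?H (T' (?N u))) u" .
  qed
qed

lemma cost_eq_L2_inner:
  assumes Q: "L2_bounded_operator tf (mult_op Q)" and R: "L2_bounded_operator tf (mult_op R)"
    and F: "L2_bounded_operator tf F" and \<psi>: "\<Psi> x0 \<in> L2 tf" and u: "u \<in> L2 tf"
  shows "cost tf Q R \<Psi> F u x0 =
    Re (L2_inner tf (\<lambda>t. \<Psi> x0 t + F u t) (mult_op Q (\<lambda>t. \<Psi> x0 t + F u t))) +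
    Re (L2_inner tf u (mult_op R u))"
proof -
  let ?y = "\<lambda>t. \<Psi> x0 t + F u t"
  have y: "?y \<in> L2 tf" using L2_bounded_operator_closed[OF F] \<psi> u by auto
  have "integrable (lebesgue_on {0..tf}) (\<lambda>t. cinner (?y t) (mult_op Q ?y t))"
    "integrable (lebesgue_on {0..tf}) (\<lambda>t. cinner (u t) (mult_op R u t))"
    using y u L2_bounded_operator_closed[OF Q] L2_bounded_operator_closed[OF R]
    by (auto intro!: L2_integrable_cinner)
  then show ?thesis
    unfolding cost_def L2_inner_def by (simp add: mult_op_def)
qed

theorem corollary4p2:
  fixes E :: "'x::chilbert_space \<Rightarrow> 'z::chilbert_space"
    and D :: "'x set" and A :: "'x \<Rightarrow> 'z"
    and B :: "'u::chilbert_space \<Rightarrow> 'z"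
    and C :: "'x \<Rightarrow> 'y::chilbert_space"
    and tf M \<omega> :: real and \<mu> \<nu> :: complex
    and XR XK :: "'x set" and P :: "'x \<Rightarrow> 'x"
    and TR T :: "real \<Rightarrow> 'x \<Rightarrow> 'x"
    and \<iota> AR1 :: "'x \<Rightarrow> 'w::cbanach" and TR1 :: "real \<Rightarrow> 'w \<Rightarrow> 'w"
    and Q :: "real \<Rightarrow> 'y \<Rightarrow>\<^sub>L 'y" and R :: "real \<Rightarrow> 'u \<Rightarrow>\<^sub>L 'u"
    and \<Psi> :: "'x \<Rightarrow> real \<Rightarrow> 'y" and F :: "(real \<Rightarrow> 'u) \<Rightarrow> (real \<Rightarrow> 'y)"
    and x0 :: 'x and u_opt :: "real \<Rightarrow> 'u" and y :: "real \<Rightarrow> 'y"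
  assumes "bounded_clinear E" and "bounded_clinear B" and "bounded_clinear C"
    and "closed_densely_defined D A"
    and "tf > 0"
    and "M > 0" and "\<omega> < 0"
    and "{s. Re s > \<omega>} \<subseteq> pencil_resolvent_set E D A"
    and "\<And>r::real. r > \<omega> \<Longrightarrow>
           \<forall>x. norm (right_resolvent E D A (complex_of_real r) x) \<le> M / (r - \<omega>) * norm x"
    and "\<mu> \<in> pencil_resolvent_set E D A"
    and "XK = space_K E D A \<mu>" and "XR = space_R E D A \<mu>"
    and "is_projection P XR XK"
    and "C0_semigroup_on XR TR" and "generator_graph XR TR = A_R_graph E D A \<mu>"
    and "T = (\<lambda>t x. TR t (P x))"
    and "exponentially_stable T"
    and "\<exists>K. \<forall>s. Re s > 0 \<longrightarrow> (\<forall>v. norm (transfer_function E D A B C s v) \<le> K * norm v)"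
    and "is_extrapolation XR (A_R_graph E D A \<mu>) TR \<nu> \<iota> AR1 TR1"
    and "Q \<in> Linf_op tf" and "pointwise_selfadjoint tf Q"
    and "R \<in> Linf_op tf" and "pointwise_selfadjoint tf R"
    and "\<Psi> = output_map T C"
    and "is_input_output_operator tf XR \<iota> AR1 TR1 (B_hat_1 D A P B) (B_hat_0 D A P B) C F"
    and "L2_coercive tf (popov tf Q R F)"
    and "L2_coercive tf (mult_op R)"
    and "u_opt \<in> L2 tf" and "\<forall>v\<in>L2 tf. cost tf Q R \<Psi> F u_opt x0 \<le> cost tf Q R \<Psi> F v x0"
    and "y = (\<lambda>t. \<Psi> x0 t + F u_opt t)"
  shows "L2_boundedly_invertible tf (feedback_op tf Q R F) \<and>
         (AE t in lebesgue_on {0..tf}. u_opt t =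
           - L2_inverse tf (feedback_op tf Q R F)
               (L2_inverse tf (popov tf Q R F) (L2_adjoint tf F (mult_op Q y))) t)"
proof -
  have Q: "L2_selfadjoint tf (mult_op Q)" and R: "L2_selfadjoint tf (mult_op R)"
    using assms by (auto intro: L2_selfadjoint_mult_op)
  note BQ = L2_selfadjoint_bounded[OF Q] and BR = L2_selfadjoint_bounded[OF R]
  have F: "L2_bounded_operator tf F"
    using \<open>is_input_output_operator tf XR \<iota> AR1 TR1 _ _ C F\<close>
    by (simp add: is_input_output_operator_def)
  have \<psi>: "\<Psi> x0 \<in> L2 tf"
    unfolding \<open>\<Psi> = _\<close> \<open>T = _\<close>
    using \<open>bounded_clinear C\<close> \<open>is_projection P XR XK\<close> \<open>C0_semigroup_on XR TR\<close>
      \<open>exponentially_stable T\<close>[unfolded \<open>T = _\<close>]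
    by (rule output_map_in_L2)
  let ?F' = "L2_adjoint tf F"
  let ?G = "\<lambda>u. ?F' (mult_op Q (F u))"
  let ?N = "popov tf Q R F"
  let ?N' = "L2_inverse tf ?N"
  let ?R' = "L2_inverse tf (mult_op R)"
  let ?H = "feedback_op tf Q R F"
  let ?H' = "L2_inverse tf ?H"
  have N_eq: "?N = (\<lambda>u t. mult_op R u t + ?G u t)"
    by (simp add: popov_def[abs_def])
  have H_eq: "?H = (\<lambda>u t. u t - ?N' (?G u) t)"
    by (simp add: feedback_op_def[abs_def])
  have G: "L2_selfadjoint tf ?G" using F Q by (rule L2_selfadjoint_conjugate)
  note BG = L2_selfadjoint_bounded[OF G]
  have N: "L2_selfadjoint tf ?N"
    unfolding N_eq using R G by (rule L2_selfadjoint_sum)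
  have R': "L2_is_inverse tf (mult_op R) ?R'"
    using R \<open>L2_coercive tf (mult_op R)\<close> by (rule L2_coercive_imp_is_inverse)
  have N': "L2_is_inverse tf ?N ?N'"
    using N \<open>L2_coercive tf ?N\<close> by (rule L2_coercive_imp_is_inverse)
  note BN' = L2_is_inverseD(1)[OF N']
  have N'_sum: "L2_is_inverse tf (\<lambda>u t. mult_op R u t + ?G u t) ?N'"
    using N' by (subst N_eq[symmetric])
  have BH: "L2_bounded_operator tf ?H"
    unfolding H_eq by (rule L2_inverse_minus_perturbation(1)[OF BR BG R' N'_sum])
  have H_R: "L2_eq tf (?H u) (?N' (mult_op R u))" if "u \<in> L2 tf" for u
    unfolding H_eq by (rule L2_inverse_minus_perturbation(2)[OF BR BG R' N'_sum that])
  have H': "L2_is_inverse tf ?H ?H'"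
    \<comment> \<open>The explicit inverse serves only to show that the chosen \<open>?H'\<close> is
      an inverse.\<close>
    using L2_inverse_minus_perturbation(3)[OF BR BG R' N'_sum] unfolding H_eq[symmetric]
    by (rule L2_is_inverse_L2_inverse)
  note BH' = L2_is_inverseD(1)[OF H']
  note closed = L2_bounded_operator_closed[OF F] L2_bounded_operator_closed[OF BQ]
    L2_bounded_operator_closed[OF BR] L2_bounded_operator_closed[OF L2_adjoint(1)[OF F]]
    L2_bounded_operator_closed[OF BN'] L2_bounded_operator_closed[OF BH]
    L2_bounded_operator_closed[OF BH']
  note u = \<open>u_opt \<in> L2 tf\<close>
  have y: "y \<in> L2 tf" unfolding \<open>y = _\<close> using \<psi> u closed by auto
  let ?f = "?F' (mult_op Q y)"
  have f: "?f \<in> L2 tf" using y closed by auto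
  have "L2_eq tf (\<lambda>t. mult_op R u_opt t + ?f t) (\<lambda>t. 0)"
    unfolding \<open>y = _\<close>
  proof (rule L2_minimizer_stationary[OF Q R F \<psi> u])
    fix v :: "real \<Rightarrow> 'u" assume v: "v \<in> L2 tf"
    \<comment> \<open>The quadratic coefficient of the cost along \<open>v\<close> is the Popov form
      at \<open>v\<close>, so its coercivity gives the sign.\<close>
    have "0 \<le> Re (L2_inner tf v (?N v))"
      using \<open>L2_coercive tf ?N\<close> v by (rule L2_coercive_nonneg)
    then show "0 \<le> Re (L2_inner tf (F v) (mult_op Q (F v))) + Re (L2_inner tf v (mult_op R v))"
      unfolding N_eq using v closed by (simp add: L2_inner_add_right L2_adjoint(2)[OF F])
    show "Re (L2_inner tf (\<lambda>t. \<Psi> x0 t + F u_opt t) (mult_op Q (\<lambda>t. \<Psi> x0 t + F u_opt t))) +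
        Re (L2_inner tf u_opt (mult_op R u_opt)) \<le>
        Re (L2_inner tf (\<lambda>t. \<Psi> x0 t + F v t) (mult_op Q (\<lambda>t. \<Psi> x0 t + F v t))) +
        Re (L2_inner tf v (mult_op R v))"
      using \<open>\<forall>v\<in>L2 tf. cost tf Q R \<Psi> F u_opt x0 \<le> cost tf Q R \<Psi> F v x0\<close> v u
      by (simp add: cost_eq_L2_inner[of tf Q R F \<Psi> x0, OF BQ BR F \<psi>])
  qed
  then have Ru: "L2_eq tf (mult_op R u_opt) (\<lambda>t. - ?f t)"
    unfolding L2_eq_def by eventually_elim (simp add: eq_neg_iff_add_eq_0)
  \<comment> \<open>Since \<open>?H\<close> is \<open>?N'\<close> after \<open>R\<close>, the
    stationarity relation expresses \<open>?H u_opt\<close> through the output \<open>y\<close>;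
    applying \<open>?H'\<close> then isolates the control.\<close>
  have "L2_eq tf (?H u_opt) (?N' (mult_op R u_opt))" using u by (rule H_R)
  also have "L2_eq tf (?N' (mult_op R u_opt)) (?N' (\<lambda>t. - ?f t))"
    using u f Ru closed by (intro L2_bounded_operator_cong[OF BN']) auto
  also have "L2_eq tf (?N' (\<lambda>t. - ?f t)) (\<lambda>t. - ?N' ?f t)"
    using f by (rule L2_bounded_operator_uminus[OF BN'])
  finally have Hu: "L2_eq tf (?H u_opt) (\<lambda>t. - ?N' ?f t)" .
  have "L2_eq tf u_opt (?H' (?H u_opt))" by (rule L2_eq_sym[OF L2_is_inverseD(2)[OF H' u]])
  also have "L2_eq tf (?H' (?H u_opt)) (?H' (\<lambda>t. - ?N' ?f t))"
    using u f Hu closed by (intro L2_bounded_operator_cong[OF BH']) auto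
  also have "L2_eq tf (?H' (\<lambda>t. - ?N' ?f t)) (\<lambda>t. - ?H' (?N' ?f) t)"
    using f closed by (intro L2_bounded_operator_uminus[OF BH']) auto
  finally have "L2_eq tf u_opt (\<lambda>t. - ?H' (?N' ?f) t)" .
  moreover have "L2_boundedly_invertible tf ?H"
    using BH H' by (auto simp: L2_boundedly_invertible_def)
  ultimately show ?thesis by (simp add: L2_eq_def)
qed

end
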